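(* Let $S(t)$ be an asymptotically compact semiflow on a complete metric space $X$, let $\mathscr{A}$ be an attractor of $S(t)$ with attraction basin $\Omega=\Omega(\mathscr{A})$ and Morse decomposition $\mathcal{M}=\{M_1,\dots,M_l\}$, and let $V$ be a strict Morse-Lyapunov function of $\mathcal{M}$ on $\Omega$ with generalized critical values $c_k=V(M_k)$, $1\le k\le l$. Let $\widetilde V$ be the induced function on the quotient $\widetilde\Omega$, let $\widetilde C_*(M_k)$ be the quotient critical groups, let $b>c_l$, and put $$\widetilde m_q=\sum_{k=1}^l\operatorname{rank}\widetilde C_q(M_k),\qquad \widetilde\beta_q=\operatorname{rank}H_q(\widetilde V_b),\qquad q=0,1,2,\dots.$$ Assume that all the quotient critical groups of the Morse sets are of finite rank. Then for any $q\ge0$, $$\widetilde m_q-\widetilde m_{q-1}+\cdots+(-1)^q\widetilde m_0\ \ge\ \widetilde\beta_q-\widetilde\beta_{q-1}+\cdots+(-1)^q\widetilde\beta_0.$$ Moreover, $$\sum_{q=0}^\infty(-1)^q\widetilde m_q=\sum_{q=0}^\infty(-1)^q\widetilde\beta_q,$$ provided that the left-hand side of this equation is convergent.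
   Context: $H_*$ denotes singular homology with coefficients in a given abelian group $\mathscr{G}$. $(X,d)$ is a complete metric space. $C(U)$ denotes the continuous real-valued functions on $U$. A semiflow on $X$ is a continuous map $S:[0,\infty)\times X\to X$, written $S(t)x=S(t,x)$, with $S(0)x=x$ and $S(t+s)x=S(t)S(s)x$ for all $t,s\ge 0$, $x\in X$. It is asymptotically compact if, whenever $(x_n)$ is a bounded sequence in $X$, $t_n\to+\infty$ and $(S(t_n)x_n)$ is bounded, the sequence $(S(t_n)x_n)$ has a convergent subsequence. For $A\subset X$ and $\varepsilon>0$, $B(A,\varepsilon)=\{y\in X: d(y,A)<\varepsilon\}$. A set $U$ is a neighborhood of $A$ if $\overline{A}\subset\operatorname{int}U$. $A$ attracts $B\subset X$ if for every $\varepsilon>0$ there is $T>0$ with $S(t)B\subset B(A,\varepsilon)$ for all $t>T$. $A$ is invariant if $S(t)A=A$ for all $t\ge0$. An attractor is a compact invariant set that attracts some neighborhood of itself. The attraction basin of $A$ is $\Omega(A)=\{x: \lim_{t\to\infty}d(S(t)x,A)=0\}$ (an open set when $A$ is an attractor). Morse decompositions: let $\mathscr{A}$ be an attractor. A compact set $A\subset\mathscr{A}$ is an attractor of $S(t)$ in $\mathscr{A}$ if it is an attractor of the restriction of $S(t)$ to $\mathscr{A}$ (the empty set is allowed). Its dual repeller is $A^*=\{x\in\mathscr{A}:\omega(x)\cap A=\emptyset\}$, where $\omega(x)=\{y:\exists\,t_n\to+\infty,\ S(t_n)x\to y\}$. An ordered collection $\mathcal{M}=\{M_1,\dots,M_l\}$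 of subsets of $\mathscr{A}$ is a Morse decomposition of $\mathscr{A}$, with Morse sets $M_k$, if there is a strictly increasing sequence $\emptyset=A_0\subsetneq A_1\subsetneq\cdots\subsetneq A_l=\mathscr{A}$ of attractors of $S(t)$ in $\mathscr{A}$ such that $M_k=A_k\cap A_{k-1}^*$ for $1\le k\le l$. Put $\mathcal{R}=\bigcup_{1\le k\le l}M_k$. A function $V\in C(\Omega)$ is a Morse-Lyapunov function of $\mathcal{M}$ on $\Omega$ if (1) $V$ is constant on each $M_k$ and (2) $t\mapsto V(S(t)x)$ is strictly decreasing in $t$ for each $x\in\Omega\setminus\mathcal{R}$. It is strict if in addition $V(M_1)<V(M_2)<\cdots<V(M_l)$, where $V(M_k)$ is the constant value of $V$ on $M_k$. The generalized critical values of $V$ are the numbers $c_k=V(M_k)$. Quotient: define an equivalence relation on $X$ by: for $x\ne y$, $x\sim y$ iff $x$ and $y$ belong to the same Morse set. Let $\widetilde X=X/\!\sim$ with the quotient topology, $[x]$ the class of $x$, and $\widetilde\Omega$ the image of $\Omega$; each $M_k$ is collapsed to a single point $[M_k]$. Set $\widetilde V([x])=V(x)$ for $[x]\in\widetilde\Omega$, which is well defined and continuous, and $\widetilde V_R=\{[x]\in\widetilde\Omega:\widetilde V([x])\le R\}$. Quotient critical groups: $\widetilde C_q(M_k)=H_q(\widetilde V_{b'},\widetilde V_{a'})$, $q=0,1,2,\dots$, where $a'<c_k<b'$ are such that $c_k$ is the unique generalized critical value of $V$ in $[a',b']$. *)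

theory Defs
  imports "HOL-Homology.Homology" "HOL-Library.Extended_Nat"
begin

section \<open>Singular homology with coefficients in an abelian group\<close>

text \<open>HOL-Homology only treats integer coefficients. Its simplices, faces and conventions are
  kept here; only the coefficients of the chains are changed.\<close>

type_synonym ('a, 'g) coeff_chain = "((nat \<Rightarrow> real) \<Rightarrow> 'a) \<Rightarrow>\<^sub>0 'g"

definition coeff_singular_chain ::
    "nat \<Rightarrow> 'a topology \<Rightarrow> ('a, 'g::ab_group_add) coeff_chain \<Rightarrow> bool" where
  "coeff_singular_chain p X c \<longleftrightarrow> Poly_Mapping.keys c \<subseteq> singular_simplex_set p X"

definition coeff_boundary ::
    "nat \<Rightarrow> ('a, 'g::ab_group_add) coeff_chain \<Rightarrow> ('a, 'g) coeff_chain" where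
  "coeff_boundary p c =
     (if p = 0 then 0
      else \<Sum>f\<in>Poly_Mapping.keys c. \<Sum>k\<le>p.
             Poly_Mapping.single (singular_face p k f)
               (if even k then Poly_Mapping.lookup c f else - Poly_Mapping.lookup c f))"

definition coeff_relcycles ::
    "nat \<Rightarrow> 'a topology \<Rightarrow> 'a set \<Rightarrow> ('a, 'g::ab_group_add) coeff_chain set" where
  "coeff_relcycles p X S =
     {c. coeff_singular_chain p X c \<and>
         coeff_singular_chain (p - 1) (subtopology X S) (coeff_boundary p c)}"

definition coeff_relboundaries ::
    "nat \<Rightarrow> 'a topology \<Rightarrow> 'a set \<Rightarrow> ('a, 'g::ab_group_add) coeff_chain set" where
  "coeff_relboundaries p X S =
     {c. \<exists>d. coeff_singular_chain (Suc p) X d \<and>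
             coeff_singular_chain p (subtopology X S) (coeff_boundary (Suc p) d - c)}"

definition coeff_relcycle_group ::
    "nat \<Rightarrow> 'a topology \<Rightarrow> 'a set \<Rightarrow> ('a, 'g::ab_group_add) coeff_chain monoid" where
  "coeff_relcycle_group p X S = \<lparr>carrier = coeff_relcycles p X S, mult = (+), one = 0\<rparr>"

definition coeff_relative_homology_group ::
    "nat \<Rightarrow> 'a topology \<Rightarrow> 'a set \<Rightarrow> ('a, 'g::ab_group_add) coeff_chain set monoid" where
  "coeff_relative_homology_group p X S = coeff_relcycle_group p X S Mod coeff_relboundaries p X S"

text \<open>For integer coefficients this is the homology of the library.\<close>

lemma coeff_boundary_int: "coeff_boundary p c = chain_boundary p (c :: 'a chain)"
proof -
  have single: "Poly_Mapping.single s (if even k then a else - a) =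
      frag_cmul a (frag_cmul ((-1) ^ k) (frag_of s))"
    for a :: int and k :: nat and s :: "(nat \<Rightarrow> real) \<Rightarrow> 'a"
    by (rule poly_mapping_eqI) (auto simp: lookup_single when_def)
  show ?thesis
    unfolding coeff_boundary_def chain_boundary_def frag_extend_def
    by (simp only: single frag_cmul_sum)
qed

lemma coeff_relative_homology_group_int:
  "coeff_relative_homology_group p X S = relative_homology_group (int p) X (S :: 'a set)"
proof -
  have "(coeff_relcycles p X S :: 'a chain set) = singular_relcycle_set p X S"
    by (auto simp: coeff_relcycles_def singular_relcycle_def coeff_singular_chain_def
        singular_chain_def mod_subset_def coeff_boundary_int)
  moreover have "relcycle_group p X S =
      \<lparr>carrier = singular_relcycle_set p X S, mult = (+), one = 0\<rparr>"
    by (intro monoid.equality) simp_all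
  moreover have "(coeff_relboundaries p X S :: 'a chain set) = singular_relboundary_set p X S"
    by (auto simp: coeff_relboundaries_def singular_relboundary_def coeff_singular_chain_def
        singular_chain_def mod_subset_def coeff_boundary_int)
  ultimately show ?thesis
    by (simp only: coeff_relative_homology_group_def coeff_relcycle_group_def
        nontrivial_relative_homology_group)
qed


section \<open>Rank of an abelian group\<close>

definition int_independent :: "('a, 'b) monoid_scheme \<Rightarrow> 'a set \<Rightarrow> bool" where
  "int_independent G B \<longleftrightarrow> B \<subseteq> carrier G \<and> finite B \<and>
     (\<forall>n :: 'a \<Rightarrow> int. (\<Otimes>\<^bsub>G\<^esub>x\<in>B. x [^]\<^bsub>G\<^esub> n x) = \<one>\<^bsub>G\<^esub> \<longrightarrow> (\<forall>x\<in>B. n x = 0))"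

definition group_rank :: "('a, 'b) monoid_scheme \<Rightarrow> enat" where
  "group_rank G = (SUP B \<in> {B. int_independent G B}. enat (card B))"


section \<open>Semiflows, attractors and Morse decompositions\<close>

text \<open>The metric space is the whole type; a semiflow is a function whose values at negative times
  are irrelevant.\<close>

definition semiflow :: "(real \<Rightarrow> 'a::metric_space \<Rightarrow> 'a) \<Rightarrow> bool" where
  "semiflow S \<longleftrightarrow>
     continuous_on ({0..} \<times> UNIV) (\<lambda>(t, x). S t x) \<and>
     (\<forall>x. S 0 x = x) \<and>
     (\<forall>t\<ge>0. \<forall>s\<ge>0. \<forall>x. S (t + s) x = S t (S s x))"

definition asymptotically_compact :: "(real \<Rightarrow> 'a::metric_space \<Rightarrow> 'a) \<Rightarrow> bool" where
  "asymptotically_compact S \<longleftrightarrow>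
     (\<forall>(x :: nat \<Rightarrow> 'a) (t :: nat \<Rightarrow> real).
        bounded (range x) \<and> (\<forall>n. 0 \<le> t n) \<and> filterlim t at_top sequentially \<and>
        bounded (range (\<lambda>n. S (t n) (x n))) \<longrightarrow>
        (\<exists>r y. strict_mono (r :: nat \<Rightarrow> nat) \<and> (\<lambda>n. S (t (r n)) (x (r n))) \<longlonglongrightarrow> y))"

text \<open>The distance to the empty set is infinite, whereas \<^term>\<open>infdist x {} = 0\<close>.\<close>

definition eps_nbhd :: "'a::metric_space set \<Rightarrow> real \<Rightarrow> 'a set" where
  "eps_nbhd A e = {y. A \<noteq> {} \<and> infdist y A < e}"

definition attracts :: "(real \<Rightarrow> 'a::metric_space \<Rightarrow> 'a) \<Rightarrow> 'a set \<Rightarrow> 'a set \<Rightarrow> bool" where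
  "attracts S A B \<longleftrightarrow> (\<forall>e>0. \<exists>T>0. \<forall>t>T. S t ` B \<subseteq> eps_nbhd A e)"

definition invariant :: "(real \<Rightarrow> 'a \<Rightarrow> 'a) \<Rightarrow> 'a set \<Rightarrow> bool" where
  "invariant S A \<longleftrightarrow> (\<forall>t\<ge>0. S t ` A = A)"

text \<open>Neighborhoods and attractors are defined relative to a phase space \<open>Y\<close>, so that they
  apply both to the full space and to the restriction of a semiflow to an invariant set.\<close>

definition neighborhood_in :: "'a::metric_space set \<Rightarrow> 'a set \<Rightarrow> 'a set \<Rightarrow> bool" where
  "neighborhood_in Y A U \<longleftrightarrow>
     A \<subseteq> Y \<and> U \<subseteq> Y \<and> top_of_set Y closure_of A \<subseteq> top_of_set Y interior_of U"

definition attractor_in :: "(real \<Rightarrow> 'a::metric_space \<Rightarrow> 'a) \<Rightarrow> 'a set \<Rightarrow> 'a set \<Rightarrow> bool" where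
  "attractor_in S Y A \<longleftrightarrow>
     A \<subseteq> Y \<and> compact A \<and> invariant S A \<and> (\<exists>U. neighborhood_in Y A U \<and> attracts S A U)"

abbreviation attractor :: "(real \<Rightarrow> 'a::metric_space \<Rightarrow> 'a) \<Rightarrow> 'a set \<Rightarrow> bool" where
  "attractor S A \<equiv> attractor_in S UNIV A"

definition attraction_basin :: "(real \<Rightarrow> 'a::metric_space \<Rightarrow> 'a) \<Rightarrow> 'a set \<Rightarrow> 'a set" where
  "attraction_basin S A = {x. A \<noteq> {} \<and> ((\<lambda>t. infdist (S t x) A) \<longlongrightarrow> 0) at_top}"

definition omega_limit :: "(real \<Rightarrow> 'a::metric_space \<Rightarrow> 'a) \<Rightarrow> 'a \<Rightarrow> 'a set" where
  "omega_limit S x =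
     {y. \<exists>t :: nat \<Rightarrow> real. (\<forall>n. 0 \<le> t n) \<and> filterlim t at_top sequentially \<and>
           (\<lambda>n. S (t n) x) \<longlonglongrightarrow> y}"

definition dual_repeller ::
    "(real \<Rightarrow> 'a::metric_space \<Rightarrow> 'a) \<Rightarrow> 'a set \<Rightarrow> 'a set \<Rightarrow> 'a set" where
  "dual_repeller S \<A> A = {x \<in> \<A>. omega_limit S x \<inter> A = {}}"

text \<open>The Morse sets are \<open>M 1, \<dots>, M l\<close>; the values of \<open>M\<close> at other indices are irrelevant.\<close>

definition morse_decomposition ::
    "(real \<Rightarrow> 'a::metric_space \<Rightarrow> 'a) \<Rightarrow> 'a set \<Rightarrow> nat \<Rightarrow> (nat \<Rightarrow> 'a set) \<Rightarrow> bool" where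
  "morse_decomposition S \<A> l M \<longleftrightarrow>
     1 \<le> l \<and>
     (\<exists>A :: nat \<Rightarrow> 'a set.
        A 0 = {} \<and> A l = \<A> \<and> (\<forall>k<l. A k \<subset> A (Suc k)) \<and>
        (\<forall>k\<le>l. attractor_in S \<A> (A k)) \<and>
        (\<forall>k\<in>{1..l}. M k = A k \<inter> dual_repeller S \<A> (A (k - 1))))"


section \<open>Morse-Lyapunov functions\<close>

definition morse_lyapunov ::
    "(real \<Rightarrow> 'a::metric_space \<Rightarrow> 'a) \<Rightarrow> 'a set \<Rightarrow> nat \<Rightarrow> (nat \<Rightarrow> 'a set) \<Rightarrow> ('a \<Rightarrow> real) \<Rightarrow> bool"
  where
  "morse_lyapunov S \<Omega> l M V \<longleftrightarrow>
     continuous_on \<Omega> V \<and>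
     (\<forall>k\<in>{1..l}. V constant_on M k) \<and>
     (\<forall>x \<in> \<Omega> - (\<Union>k\<in>{1..l}. M k). strict_antimono_on {0..} (\<lambda>t. V (S t x)))"

text \<open>\<^term>\<open>the_elem (V ` M)\<close> is the value of \<open>V\<close> on the nonempty set \<open>M\<close> on which it is
  constant.\<close>

definition critical_value :: "('a \<Rightarrow> real) \<Rightarrow> 'a set \<Rightarrow> real" where
  "critical_value V M = the_elem (V ` M)"

definition strict_morse_lyapunov ::
    "(real \<Rightarrow> 'a::metric_space \<Rightarrow> 'a) \<Rightarrow> 'a set \<Rightarrow> nat \<Rightarrow> (nat \<Rightarrow> 'a set) \<Rightarrow> ('a \<Rightarrow> real) \<Rightarrow> bool"
  where
  "strict_morse_lyapunov S \<Omega> l M V \<longleftrightarrow>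
     morse_lyapunov S \<Omega> l M V \<and> strict_mono_on {1..l} (\<lambda>k. critical_value V (M k))"


section \<open>Collapsing the Morse sets\<close>

definition morse_rel :: "nat \<Rightarrow> (nat \<Rightarrow> 'a set) \<Rightarrow> ('a \<times> 'a) set" where
  "morse_rel l M = {(x, y). x = y \<or> (\<exists>k\<in>{1..l}. x \<in> M k \<and> y \<in> M k)}"

definition quotient_topology :: "('a::topological_space \<times> 'a) set \<Rightarrow> 'a set topology" where
  "quotient_topology r = topology (\<lambda>U. U \<subseteq> UNIV // r \<and> open {x. r `` {x} \<in> U})"

lemma openin_quotient_topology:
  "openin (quotient_topology r) U \<longleftrightarrow> U \<subseteq> UNIV // r \<and> open {x. r `` {x} \<in> U}"
proof -
  have "istopology (\<lambda>U. U \<subseteq> UNIV // r \<and> open {x. r `` {x} \<in> U})"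
    unfolding istopology_def
  proof (intro conjI allI impI)
    fix A B
    assume "A \<subseteq> UNIV // r \<and> open {x. r `` {x} \<in> A}" "B \<subseteq> UNIV // r \<and> open {x. r `` {x} \<in> B}"
    then show "A \<inter> B \<subseteq> UNIV // r" "open {x. r `` {x} \<in> A \<inter> B}"
      using open_Int[of "{x. r `` {x} \<in> A}" "{x. r `` {x} \<in> B}"]
      by (auto simp: Collect_conj_eq)
  next
    fix \<K>
    assume K: "\<forall>K\<in>\<K>. K \<subseteq> UNIV // r \<and> open {x. r `` {x} \<in> K}"
    then show "\<Union>\<K> \<subseteq> UNIV // r" by blast
    have "{x. r `` {x} \<in> \<Union>\<K>} = (\<Union>K\<in>\<K>. {x. r `` {x} \<in> K})" by blast
    then show "open {x. r `` {x} \<in> \<Union>\<K>}" using K by auto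
  qed
  then show ?thesis
    by (simp add: quotient_topology_def topology_inverse')
qed

lemma topspace_quotient_topology: "topspace (quotient_topology r) = UNIV // r"
proof -
  have "{x. r `` {x} \<in> UNIV // r} = UNIV" by (auto intro: quotientI)
  then have "openin (quotient_topology r) (UNIV // r)"
    by (simp add: openin_quotient_topology)
  then show ?thesis
    by (meson openin_quotient_topology openin_subset openin_topspace subset_antisym)
qed

lemma quotient_map_quotient_topology:
  "quotient_map euclidean (quotient_topology r) (\<lambda>x. r `` {x})"
  unfolding quotient_map_def
  by (auto simp: topspace_quotient_topology openin_quotient_topology quotient_def)

text \<open>The value at a class is the common value of \<open>V\<close> on its elements.\<close>

definition quotient_fun :: "('a \<Rightarrow> real) \<Rightarrow> 'a set \<Rightarrow> real" where
  "quotient_fun V C = the_elem (V ` C)"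

definition quotient_sublevel ::
    "'a set \<Rightarrow> nat \<Rightarrow> (nat \<Rightarrow> 'a set) \<Rightarrow> ('a \<Rightarrow> real) \<Rightarrow> real \<Rightarrow> 'a set set" where
  "quotient_sublevel \<Omega> l M V R = {C \<in> \<Omega> // morse_rel l M. quotient_fun V C \<le> R}"

lemma quotient_fun_class:
  assumes "\<And>k. k \<in> {1..l} \<Longrightarrow> V constant_on M k"
  shows "quotient_fun V (morse_rel l M `` {x}) = V x"
proof -
  have "V ` (morse_rel l M `` {x}) = {V x}"
    using assms by (fastforce simp: morse_rel_def constant_on_def)
  then show ?thesis by (simp add: quotient_fun_def)
qed

lemma equiv_morse_rel:
  assumes "strict_morse_lyapunov S \<Omega> l M V"
  shows "equiv UNIV (morse_rel l M)"
proof -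
  have crit: "critical_value V (M k) = V x" if "k \<in> {1..l}" "x \<in> M k" for k x
  proof -
    have "V constant_on M k"
      using assms that(1) by (simp add: strict_morse_lyapunov_def morse_lyapunov_def)
    then have "V ` M k = {V x}"
      using that(2) by (fastforce simp: constant_on_def)
    then show ?thesis by (simp add: critical_value_def)
  qed
  have inj: "inj_on (\<lambda>k. critical_value V (M k)) {1..l}"
    using assms by (simp add: strict_morse_lyapunov_def strict_mono_on_imp_inj_on)
  have disj: "j = k" if "j \<in> {1..l}" "k \<in> {1..l}" "x \<in> M j" "x \<in> M k" for j k x
    using inj_onD[OF inj, of j k] crit that by simp
  show ?thesis
  proof (rule equivI)
    show "trans (morse_rel l M)"
      unfolding trans_def morse_rel_def using disj by blast
  qed (auto simp: refl_on_def sym_def morse_rel_def)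
qed


section \<open>Quotient critical groups\<close>

definition sublevel_homology ::
    "'a::metric_space set \<Rightarrow> nat \<Rightarrow> (nat \<Rightarrow> 'a set) \<Rightarrow> ('a \<Rightarrow> real) \<Rightarrow> nat \<Rightarrow> real \<Rightarrow>
     ('a set, 'g::ab_group_add) coeff_chain set monoid" where
  "sublevel_homology \<Omega> l M V q b =
     coeff_relative_homology_group q
       (subtopology (quotient_topology (morse_rel l M)) (quotient_sublevel \<Omega> l M V b)) {}"

definition isolates_critical_value ::
    "nat \<Rightarrow> (nat \<Rightarrow> 'a set) \<Rightarrow> ('a \<Rightarrow> real) \<Rightarrow> nat \<Rightarrow> real \<Rightarrow> real \<Rightarrow> bool" where
  "isolates_critical_value l M V k a' b' \<longleftrightarrow>
     a' < critical_value V (M k) \<and> critical_value V (M k) < b' \<and>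
     {a'..b'} \<inter> (\<lambda>j. critical_value V (M j)) ` {1..l} = {critical_value V (M k)}"

text \<open>The quotient critical group of the Morse set \<open>M k\<close>, computed from levels
  \<open>a'\<close> and \<open>b'\<close> such that \<^term>\<open>isolates_critical_value l M V k a' b'\<close>.\<close>

definition quotient_critical_group ::
    "'a::metric_space set \<Rightarrow> nat \<Rightarrow> (nat \<Rightarrow> 'a set) \<Rightarrow> ('a \<Rightarrow> real) \<Rightarrow> nat \<Rightarrow> real \<Rightarrow> real \<Rightarrow>
     ('a set, 'g::ab_group_add) coeff_chain set monoid" where
  "quotient_critical_group \<Omega> l M V q a' b' =
     coeff_relative_homology_group q
       (subtopology (quotient_topology (morse_rel l M)) (quotient_sublevel \<Omega> l M V b'))
       (quotient_sublevel \<Omega> l M V a')"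

end

theory Submission
  imports Defs "HOL-Analysis.Abstract_Topological_Spaces"
begin

text \<open>If no generalized critical value lies in \<open>[a, b]\<close>, every point of \<open>V_b\<close> flows down to the
  level \<open>a\<close> in a finite time that depends continuously on the point. The resulting deformation
  moves no point of a Morse set, and the collapsing map is proper because Morse sets are compact,
  so it descends to the quotient and \<open>H_*(V_b, V_a) = 0\<close> there. Consequently the quotient critical
  groups do not depend on the isolating levels, and the sublevel sets at levels
  \<open>e_0 < c_1 < e_1 < c_2 < \<dots> < c_l < e_l = b\<close> form a filtration, starting with the empty set, whose
  successive relative homology groups are the critical groups. Counting ranks in the exact
  sequences of the triples of this filtration gives \<open>m_q = \<beta>_q + D_q + D_{q-1}\<close> with natural
  numbers \<open>D_q\<close>, \<open>D_{-1} = 0\<close>. The inequalities and the Euler characteristic formula follow.\<close>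

section \<open>Ranks of quotients of abelian groups\<close>

text \<open>Three obstacles shape the argument. Only the critical groups are known to have finite
  rank, so the counting takes place in \<open>enat\<close>, where nothing can be cancelled:
  exactness is recorded as equations between sums, and the finiteness of every \<beta>_q is a
  conclusion. The coefficient group is arbitrary, so vanishing of homology is proved over the
  integers, where homotopic maps can be compared, and then transferred through a contraction of the
  relative chains. Finally, a homotopy on V_b descends only if the product of [0,1] with the
  collapsing map is again a quotient map; a product of quotient maps can fail to be one, but a
  product of proper maps is proper, hence closed. The compactness of Morse sets behind this rests on
  dual repellers being closed.

  The number D_q adds up, over the stages of the filtration, the ranks of the connecting
  homomorphisms from degree q+1 to degree q. In alternating sums these cancel except for the last
  one, which is nonnegative. A convergent series of integers has only finitely many nonzero terms,
  so the Euler formula is a finite computation.\<close>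

definition int_mult :: "int \<Rightarrow> 'a::ab_group_add \<Rightarrow> 'a" where
  "int_mult n x = (\<Sum>i<nat n. x) - (\<Sum>i<nat (- n). x)"

lemma sum_const_lessThan_add: "(\<Sum>i<j + k. x) = (\<Sum>i<j. x) + (\<Sum>i<k. x)"
  for x :: "'a::ab_group_add" and j k :: nat
  by (induction k) (simp_all add: add.assoc)

text \<open>Any representation of an integer as a difference of naturals computes its multiples.
  Additivity in the integer then needs no case distinction on signs.\<close>

lemma int_mult_diff_of_nat: "int_mult (int m - int n) x = (\<Sum>i<m. x) - (\<Sum>i<n. x)"
proof (cases "n \<le> m")
  case True
  then obtain k where "m = n + k" using le_Suc_ex by blast
  then show ?thesis by (simp add: int_mult_def sum_const_lessThan_add)
next
  case False
  then obtain k where "n = m + k" using le_Suc_ex nat_le_linear by blast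
  then show ?thesis by (simp add: int_mult_def sum_const_lessThan_add)
qed

lemma int_mult_0 [simp]: "int_mult 0 x = 0"
  and int_mult_1 [simp]: "int_mult 1 x = x"
  and int_mult_minus_1 [simp]: "int_mult (- 1) x = - x"
  by (simp_all add: int_mult_def)

lemma int_mult_add_left: "int_mult (m + n) x = int_mult m x + int_mult n x"
proof -
  obtain a b where m: "m = int a - int b" by (rule int_diff_cases)
  obtain c d where n: "n = int c - int d" by (rule int_diff_cases)
  have "m + n = int (a + c) - int (b + d)" by (simp add: m n)
  then show ?thesis
    by (simp only: m n int_mult_diff_of_nat sum_const_lessThan_add) (simp add: algebra_simps)
qed

lemma int_mult_add_right: "int_mult n (x + y) = int_mult n x + int_mult n y"
  by (simp add: int_mult_def sum.distrib)

lemma int_mult_int_mult: "int_mult m (int_mult n x) = int_mult (m * n) x"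
proof (induction m rule: int_induct[where k = 0])
  case (step1 i)
  then show ?case by (simp add: int_mult_add_left distrib_right)
next
  case (step2 i)
  have "int_mult (i - 1) y = int_mult i y - y" for y :: 'a
    using int_mult_add_left[of i "-1" y] by simp
  moreover have "int_mult (i * n - n) x = int_mult (i * n) x - int_mult n x"
    using int_mult_add_left[of "i * n - n" n x] by (simp add: eq_diff_eq)
  ultimately show ?case using step2 by (simp add: left_diff_distrib)
qed simp

text \<open>Abelian groups as modules over the integers: subgroups become submodules, and closure
  under sums and multiples comes from the module theory.\<close>

interpretation zmod: Modules.module int_mult
  by unfold_locales (simp_all add: int_mult_add_left int_mult_add_right int_mult_int_mult)

abbreviation add_subgroup :: "'a::ab_group_add set \<Rightarrow> bool" where
  "add_subgroup \<equiv> zmod.subspace"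

lemma add_subgroupI:
  assumes "0 \<in> A" "\<And>x y. x \<in> A \<Longrightarrow> y \<in> A \<Longrightarrow> x - y \<in> A"
  shows "add_subgroup A"
proof -
  have minus: "- x \<in> A" if "x \<in> A" for x
    using assms(2)[OF assms(1) that] by simp
  have add: "x + y \<in> A" if "x \<in> A" "y \<in> A" for x y
    using assms(2)[OF that(1) minus[OF that(2)]] by simp
  have "int_mult n x \<in> A" if "x \<in> A" for n x
  proof (induction n rule: int_induct[where k = 0])
    case base
    then show ?case using assms(1) by simp
  next
    case (step1 i)
    then show ?case using add that by (simp add: int_mult_add_left)
  next
    case (step2 i)
    then show ?case using assms(2) that by (simp add: zmod.scale_left_diff_distrib)
  qed
  then show ?thesis
    using assms(1) add by (simp add: zmod.subspace_def)
qed

text \<open>Independence of classes modulo \<open>B\<close>, tested on representatives. Two distinct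
  congruent elements already violate it, with coefficients 1 and -1, so \<open>card F\<close> really
  counts classes.\<close>

definition indep_mod :: "'a::ab_group_add set \<Rightarrow> 'a set \<Rightarrow> bool" where
  "indep_mod B F \<longleftrightarrow> finite F \<and>
     (\<forall>n. (\<Sum>x\<in>F. int_mult (n x) x) \<in> B \<longrightarrow> (\<forall>x\<in>F. n x = 0))"

lemma indep_modD:
  "indep_mod B F \<Longrightarrow> (\<Sum>x\<in>F. int_mult (n x) x) \<in> B \<Longrightarrow> \<forall>x\<in>F. n x = 0"
  by (simp add: indep_mod_def)

text \<open>The rank of Z/B without cosets, so that all counting can be done on chains;
  \<open>group_rank_Mod\<close> identifies it with the rank of the quotient group.\<close>

definition quotient_rank :: "'a::ab_group_add set \<Rightarrow> 'a set \<Rightarrow> enat" where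
  "quotient_rank Z B = (SUP F \<in> {F. F \<subseteq> Z \<and> indep_mod B F}. enat (card F))"

lemma quotient_rank_upper: "F \<subseteq> Z \<Longrightarrow> indep_mod B F \<Longrightarrow> enat (card F) \<le> quotient_rank Z B"
  unfolding quotient_rank_def by (rule SUP_upper) simp

lemma quotient_rank_least:
  assumes "\<And>F. F \<subseteq> Z \<Longrightarrow> indep_mod B F \<Longrightarrow> enat (card F) \<le> r"
  shows "quotient_rank Z B \<le> r"
  unfolding quotient_rank_def by (rule SUP_least) (use assms in blast)

text \<open>An infinite supremum is not attained by a finite set, so only natural lower bounds are
  realised.\<close>

lemma quotient_rank_witness:
  assumes "enat n \<le> quotient_rank Z B"
  obtains F where "F \<subseteq> Z" "indep_mod B F" "n \<le> card F"
proof (cases n)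
  case 0
  have "indep_mod B {}" by (simp add: indep_mod_def)
  then show ?thesis using that[of "{}"] 0 by simp
next
  case (Suc k)
  have "\<not> quotient_rank Z B \<le> enat k"
    using assms Suc by (metis enat_ord_simps(1) not_less_eq_eq order_refl order_trans)
  then have "\<exists>F. F \<subseteq> Z \<and> indep_mod B F \<and> \<not> card F \<le> k"
    using quotient_rank_least[of Z B "enat k"] by auto
  then show ?thesis using that Suc by (auto simp: not_le Suc_le_eq)
qed

text \<open>Finite approximations suffice: if \<open>r\<close> is a natural \<open>N\<close>,
  pairing \<open>Suc N\<close> with 0 shows that neither summand is infinite, and then the summands
  themselves may be inserted.\<close>

lemma enat_add_leI:
  fixes a b r :: enat
  assumes "\<And>m n. enat m \<le> a \<Longrightarrow> enat n \<le> b \<Longrightarrow> enat (m + n) \<le> r"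
  shows "a + b \<le> r"
proof (cases r)
  case (enat N)
  have zero: "enat 0 \<le> x" for x by (simp add: zero_enat_def[symmetric])
  have "\<not> enat (Suc N) \<le> a" using assms[of "Suc N" 0, OF _ zero] enat by auto
  then have "a \<noteq> \<infinity>" by (intro notI) simp
  moreover have "\<not> enat (Suc N) \<le> b" using assms[of 0 "Suc N", OF zero] enat by auto
  then have "b \<noteq> \<infinity>" by (intro notI) simp
  ultimately obtain m n where "a = enat m" "b = enat n" by (metis enat.exhaust)
  then show ?thesis using assms[of m n] by simp
qed simp

text \<open>Passes from an indexed family to its image. If y i = y j for different indices, the
  coefficients 1 and -1 give the sum 0, which lies in \<open>B\<close>, a forbidden
  relation.\<close>

lemma indep_mod_family:
  assumes "finite I" "add_subgroup B"
    and indep: "\<And>n i. (\<Sum>i\<in>I. int_mult (n i) (y i)) \<in> B \<Longrightarrow> i \<in> I \<Longrightarrow> n i = 0"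
  shows "inj_on y I" "indep_mod B (y ` I)"
proof -
  show inj: "inj_on y I"
  proof (rule inj_onI, rule ccontr)
    fix i j assume ij: "i \<in> I" "j \<in> I" "y i = y j" "i \<noteq> j"
    define n where "n k = (if k = i then 1 else 0) + (if k = j then - 1 else 0 :: int)" for k
    have "(\<Sum>k\<in>I. int_mult (n k) (y k)) =
        (\<Sum>k\<in>I. (if k = i then y i else 0) + (if k = j then - y j else 0))"
      by (rule sum.cong) (use ij in \<open>auto simp: n_def\<close>)
    also have "\<dots> = 0" using ij assms(1) by (simp add: sum.distrib)
    finally have "n i = 0" using indep[of n i] ij zmod.subspace_0[OF assms(2)] by simp
    then show False using ij by (simp add: n_def)
  qed
  show "indep_mod B (y ` I)"
    unfolding indep_mod_def using assms(1) indep[of "\<lambda>i. _ (y i)"]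
    by (auto simp: sum.reindex[OF inj])
qed

lemma quotient_rank_family:
  assumes "finite I" "add_subgroup B" "y ` I \<subseteq> Z"
    and "\<And>n i. (\<Sum>i\<in>I. int_mult (n i) (y i)) \<in> B \<Longrightarrow> i \<in> I \<Longrightarrow> n i = 0"
  shows "enat (card I) \<le> quotient_rank Z B"
  using quotient_rank_upper[OF assms(3) indep_mod_family(2)[of I B y]]
    card_image[OF indep_mod_family(1)[of I B y]] assms by simp

text \<open>Additivity of rank along 0 -> Y/B -> Z/B -> Z/Y -> 0. For an independent set
  \<open>G\<close> in Z/B, a largest part \<open>F\<close> independent modulo \<open>Y\<close> is
  split off; each remaining element has a nonzero multiple that a combination of \<open>F\<close>
  corrects into \<open>Y\<close>. Conversely, independent sets for Z/Y and Y/B unite to one for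
  Z/B.\<close>

lemma quotient_rank_add:
  assumes B: "add_subgroup B" and Y: "add_subgroup Y" and Z: "add_subgroup Z"
    and BY: "B \<subseteq> Y" and YZ: "Y \<subseteq> Z"
  shows "quotient_rank Z B = quotient_rank Z Y + quotient_rank Y B"
proof (rule antisym)
  show "quotient_rank Z B \<le> quotient_rank Z Y + quotient_rank Y B"
  proof (rule quotient_rank_least)
    fix G assume G: "G \<subseteq> Z" "indep_mod B G"
    have finG: "finite G" using G(2) by (simp add: indep_mod_def)
    obtain F where F: "F \<subseteq> G" "indep_mod Y F"
      and maxF: "\<And>F'. F' \<subseteq> G \<Longrightarrow> indep_mod Y F' \<Longrightarrow> card F' \<le> card F"
    proof -
      have "indep_mod Y {}" by (simp add: indep_mod_def)
      then have "\<exists>F. (F \<subseteq> G \<and> indep_mod Y F) \<and> (\<forall>F'. F' \<subseteq> G \<and> indep_mod Y F' \<longrightarrow> card F' \<le> card F)"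
        by (intro ex_has_greatest_nat[where k = "{}" and b = "Suc (card G)"])
           (auto simp: less_Suc_eq_le intro: card_mono finG)
      then show ?thesis using that by blast
    qed
    have finF: "finite F" using F(2) by (simp add: indep_mod_def)
    have "\<exists>n. n g \<noteq> 0 \<and> int_mult (n g) g + (\<Sum>x\<in>F. int_mult (n x) x) \<in> Y" if g: "g \<in> G - F" for g
    proof -
      have "\<not> indep_mod Y (insert g F)"
        using maxF[of "insert g F"] F(1) g finF by auto
      then obtain n where n: "(\<Sum>x\<in>insert g F. int_mult (n x) x) \<in> Y" "\<exists>x\<in>insert g F. n x \<noteq> 0"
        using finF unfolding indep_mod_def by blast
      have eq: "(\<Sum>x\<in>insert g F. int_mult (n x) x) = int_mult (n g) g + (\<Sum>x\<in>F. int_mult (n x) x)"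
        using finF g by simp
      have "n g \<noteq> 0"
      proof
        assume "n g = 0"
        then have "(\<Sum>x\<in>F. int_mult (n x) x) \<in> Y" using n(1) eq by simp
        then show False using F(2) n(2) \<open>n g = 0\<close> by (auto simp: indep_mod_def)
      qed
      then show ?thesis using n(1) eq by auto
    qed
    then obtain n where n: "\<And>g. g \<in> G - F \<Longrightarrow> n g g \<noteq> (0::int)"
      "\<And>g. g \<in> G - F \<Longrightarrow> int_mult (n g g) g + (\<Sum>x\<in>F. int_mult (n g x) x) \<in> Y"
      by metis
    define y where "y g = int_mult (n g g) g + (\<Sum>x\<in>F. int_mult (n g x) x)" for g
    have "enat (card (G - F)) \<le> quotient_rank Y B"
    proof (rule quotient_rank_family[where y = y])
      fix k g assume sum: "(\<Sum>g\<in>G - F. int_mult (k g) (y g)) \<in> B" and g: "g \<in> G - F"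
      \<comment> \<open>Coefficients over \<open>G\<close> of a relation among the
        \<open>y g\<close>: an element of \<open>F\<close> collects a contribution from every
        \<open>g\<close>, whereas an element outside \<open>F\<close> occurs only in its own
        \<open>y\<close>. There the vanishing of \<open>m g\<close> gives \<open>k g = 0\<close>,
        because \<open>n g g\<close> is nonzero.\<close>
      define m where "m x = (if x \<in> F then \<Sum>g\<in>G - F. k g * n g x else k x * n x x)" for x
      have "(\<Sum>g\<in>G - F. int_mult (k g) (y g)) =
          (\<Sum>g\<in>G - F. int_mult (k g * n g g) g) + (\<Sum>g\<in>G - F. \<Sum>x\<in>F. int_mult (k g * n g x) x)"
        by (simp add: y_def int_mult_add_right zmod.scale_sum_right sum.distrib)
      also have "(\<Sum>g\<in>G - F. \<Sum>x\<in>F. int_mult (k g * n g x) x) = (\<Sum>x\<in>F. int_mult (m x) x)"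
        by (subst sum.swap) (simp add: m_def zmod.scale_sum_left)
      also have "(\<Sum>g\<in>G - F. int_mult (k g * n g g) g) = (\<Sum>g\<in>G - F. int_mult (m g) g)"
        by (simp add: m_def)
      also have "\<dots> + (\<Sum>x\<in>F. int_mult (m x) x) = (\<Sum>x\<in>G. int_mult (m x) x)"
        using sum.subset_diff[OF F(1) finG] by metis
      finally have "m g = 0" using sum G(2) g by (simp add: indep_mod_def)
      then show "k g = 0" using n(1)[OF g] g by (simp add: m_def)
    qed (use finG B n(2) in \<open>auto simp: y_def\<close>)
    moreover have "enat (card F) \<le> quotient_rank Z Y"
      using quotient_rank_upper[of F Z Y] F G(1) by blast
    moreover have "card G = card F + card (G - F)"
      using F(1) finG by (metis add.commute card_Diff_subset card_mono diff_add finF)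
    ultimately show "enat (card G) \<le> quotient_rank Z Y + quotient_rank Y B"
      by (metis add_mono plus_enat_simps(1))
  qed
next
  have *: "enat (card F) + enat (card E) \<le> quotient_rank Z B"
    if F: "F \<subseteq> Z" "indep_mod Y F" and E: "E \<subseteq> Y" "indep_mod B E" for F E
  proof -
    have fin: "finite F" "finite E" using F E by (auto simp: indep_mod_def)
    have EY: "(\<Sum>x\<in>E. int_mult (n x) x) \<in> Y" for n
      by (rule zmod.subspace_sum[OF Y]) (use E(1) Y in \<open>auto intro: zmod.subspace_scale\<close>)
    \<comment> \<open>Disjointness makes the cardinalities add. A common element lies in
      \<open>Y\<close>, so it would be a relation of \<open>F\<close> modulo \<open>Y\<close> with
      coefficient 1.\<close>
    have disj: "F \<inter> E = {}"
    proof (rule ccontr)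
      assume "F \<inter> E \<noteq> {}"
      then obtain x where x: "x \<in> F" "x \<in> E" by blast
      have "(\<Sum>z\<in>F. int_mult (if z = x then 1 else 0) z) = (\<Sum>z\<in>F. if z = x then x else 0)"
        by (rule sum.cong) auto
      also have "\<dots> = x" using x fin by simp
      finally have "(\<Sum>z\<in>F. int_mult (if z = x then 1 else 0) z) \<in> Y" using x(2) E(1) by auto
      then have "\<forall>z\<in>F. (if z = x then 1 else 0 :: int) = 0"
        by (rule indep_modD[OF F(2)])
      then show False using x(1) by auto
    qed
    have "indep_mod B (F \<union> E)"
      unfolding indep_mod_def
    proof (intro conjI allI impI)
      fix n assume "(\<Sum>x\<in>F \<union> E. int_mult (n x) x) \<in> B"
      then have sum: "(\<Sum>x\<in>F. int_mult (n x) x) + (\<Sum>x\<in>E. int_mult (n x) x) \<in> B"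
        using fin disj by (simp add: sum.union_disjoint)
      then have "(\<Sum>x\<in>F. int_mult (n x) x) \<in> Y"
        using EY BY zmod.subspace_diff[OF Y] by (metis add_diff_cancel_right' subsetD)
      then have nF: "\<forall>x\<in>F. n x = 0" using F(2) by (simp add: indep_mod_def)
      then have "(\<Sum>x\<in>E. int_mult (n x) x) \<in> B" using sum by simp
      then have "\<forall>x\<in>E. n x = 0" using E(2) by (simp add: indep_mod_def)
      then show "\<forall>x\<in>F \<union> E. n x = 0" using nF by blast
    qed (use fin in auto)
    then have "enat (card (F \<union> E)) \<le> quotient_rank Z B"
      using F E YZ by (intro quotient_rank_upper) auto
    then show ?thesis using card_Un_disjoint[OF fin disj] by simp
  qed
  have "enat (m + n) \<le> quotient_rank Z B"
    if mn: "enat m \<le> quotient_rank Z Y" "enat n \<le> quotient_rank Y B" for m n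
  proof -
    obtain F where F: "F \<subseteq> Z" "indep_mod Y F" "m \<le> card F"
      using mn(1) by (rule quotient_rank_witness)
    obtain E where E: "E \<subseteq> Y" "indep_mod B E" "n \<le> card E"
      using mn(2) by (rule quotient_rank_witness)
    have "enat (m + n) \<le> enat (card F) + enat (card E)" using F E by simp
    also have "\<dots> \<le> quotient_rank Z B" using *[of F E] F E by blast
    finally show ?thesis .
  qed
  then show "quotient_rank Z Y + quotient_rank Y B \<le> quotient_rank Z B"
    using enat_add_leI by blast
qed


text \<open>Immediate because \<open>int_mult\<close> is built from sums and a difference only,
  which every additive map preserves.\<close>

lemma additive_int_mult:
  assumes "Modules.additive f"
  shows "f (int_mult n x) = int_mult n (f x)"
proof -
  interpret Modules.additive f by fact
  show ?thesis unfolding int_mult_def diff sum ..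
qed

text \<open>The hypotheses \<open>into\<close>, \<open>ker\<close> and \<open>onto\<close> say that
  \<open>f\<close> induces an isomorphism Z/B -> Z'/B'. Independent representatives are carried
  forward by \<open>f\<close> and backward by a choice of preimages modulo
  \<open>B'\<close>.\<close>

lemma quotient_rank_iso:
  assumes f: "Modules.additive f"
    and B: "add_subgroup B" and B': "add_subgroup B'" and Z: "add_subgroup Z"
    and into: "\<And>z. z \<in> Z \<Longrightarrow> f z \<in> Z'"
    and ker: "\<And>z. z \<in> Z \<Longrightarrow> f z \<in> B' \<longleftrightarrow> z \<in> B"
    and onto: "\<And>z'. z' \<in> Z' \<Longrightarrow> \<exists>z\<in>Z. z' - f z \<in> B'"
  shows "quotient_rank Z B = quotient_rank Z' B'"
proof -
  interpret Modules.additive f by fact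
  have f_sum: "f (\<Sum>x\<in>F. int_mult (n x) (z x)) = (\<Sum>x\<in>F. int_mult (n x) (f (z x)))" for F n and z :: "'c \<Rightarrow> 'a"
    unfolding sum additive_int_mult[OF f] ..
  have Z_sum: "(\<Sum>x\<in>F. int_mult (n x) (z x)) \<in> Z" if "z ` F \<subseteq> Z" for F n and z :: "'c \<Rightarrow> 'a"
    by (rule zmod.subspace_sum[OF Z]) (use that in \<open>auto intro: zmod.subspace_scale[OF Z]\<close>)
  show ?thesis
  proof (rule antisym)
    show "quotient_rank Z B \<le> quotient_rank Z' B'"
    proof (rule quotient_rank_least)
      fix F assume F: "F \<subseteq> Z" "indep_mod B F"
      show "enat (card F) \<le> quotient_rank Z' B'"
      proof (rule quotient_rank_family[where y = f])
        fix n x assume "(\<Sum>x\<in>F. int_mult (n x) (f x)) \<in> B'" "x \<in> F"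
        moreover have "(\<Sum>x\<in>F. int_mult (n x) x) \<in> Z" using Z_sum[of "\<lambda>x. x" F n] F(1) by simp
        ultimately have "(\<Sum>x\<in>F. int_mult (n x) x) \<in> B"
          using ker[of "\<Sum>x\<in>F. int_mult (n x) x"] f_sum[of n "\<lambda>x. x" F] by simp
        then show "n x = 0" using indep_modD[OF F(2)] \<open>x \<in> F\<close> by blast
      qed (use F into B' in \<open>auto simp: indep_mod_def\<close>)
    qed
    show "quotient_rank Z' B' \<le> quotient_rank Z B"
    proof (rule quotient_rank_least)
      fix F assume F: "F \<subseteq> Z'" "indep_mod B' F"
      obtain g where g: "\<And>z'. z' \<in> Z' \<Longrightarrow> g z' \<in> Z" "\<And>z'. z' \<in> Z' \<Longrightarrow> z' - f (g z') \<in> B'"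
        using onto by metis
      show "enat (card F) \<le> quotient_rank Z B"
      proof (rule quotient_rank_family[where y = g])
        fix n x assume sum: "(\<Sum>x\<in>F. int_mult (n x) (g x)) \<in> B" and x: "x \<in> F"
        have "(\<Sum>x\<in>F. int_mult (n x) (g x)) \<in> Z" by (rule Z_sum) (use g F(1) in auto)
        then have "f (\<Sum>x\<in>F. int_mult (n x) (g x)) \<in> B'" using sum ker by blast
        moreover have "(\<Sum>x\<in>F. int_mult (n x) (x - f (g x))) \<in> B'"
          by (rule zmod.subspace_sum[OF B']) (use g F in \<open>auto intro: zmod.subspace_scale[OF B']\<close>)
        ultimately have "f (\<Sum>x\<in>F. int_mult (n x) (g x)) + (\<Sum>x\<in>F. int_mult (n x) (x - f (g x))) \<in> B'"
          by (rule zmod.subspace_add[OF B'])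
        moreover have "f (\<Sum>x\<in>F. int_mult (n x) (g x)) + (\<Sum>x\<in>F. int_mult (n x) (x - f (g x))) =
            (\<Sum>x\<in>F. int_mult (n x) x)"
          by (simp add: f_sum zmod.scale_right_diff_distrib sum_subtractf)
        ultimately have "(\<Sum>x\<in>F. int_mult (n x) x) \<in> B'" by simp
        then show "n x = 0" using indep_modD[OF F(2)] x by blast
      qed (use F g B in \<open>auto simp: indep_mod_def\<close>)
    qed
  qed
qed


lemma quotient_rank_self:
  assumes "add_subgroup Z"
  shows "quotient_rank Z Z = 0"
proof -
  have "card F = 0" if F: "F \<subseteq> Z" "indep_mod Z F" for F
  proof -
    have "(\<Sum>x\<in>F. int_mult 1 x) \<in> Z" using F(1) by (auto intro: zmod.subspace_sum[OF assms])
    then have "\<forall>x\<in>F. (1::int) = 0" by (rule indep_modD[OF F(2)])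
    then show ?thesis by auto
  qed
  then show ?thesis
    using quotient_rank_least[of Z Z 0] by (simp flip: zero_enat_def)
qed

text \<open>Powers of cosets are cosets of multiples, and products of cosets are cosets of sums.
  Thus a multiplicative relation in the quotient group is the same thing as a relation modulo
  \<open>B\<close> among representatives.\<close>

lemma group_rank_Mod:
  fixes Z B :: "'a::ab_group_add set"
  assumes Z: "add_subgroup Z" and B: "add_subgroup B" and BZ: "B \<subseteq> Z"
  defines "G \<equiv> \<lparr>carrier = Z, mult = (+), one = 0\<rparr>"
  shows "group_rank (G Mod B) = quotient_rank Z B"
proof -
  have G_simps: "carrier G = Z" "monoid.mult G = (+)" "one G = 0" by (simp_all add: G_def)
  have neg: "\<exists>y\<in>Z. x + y = 0" if "x \<in> Z" for x
    using zmod.subspace_neg[OF Z that] by (intro bexI[of _ "- x"]) auto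
  interpret G: comm_group G
    by (rule comm_groupI) (simp_all add: G_simps zmod.subspace_add[OF Z] zmod.subspace_0[OF Z] add_ac neg)
  have inv: "inv\<^bsub>G\<^esub> x = - x" if "x \<in> Z" for x
    by (rule G.inv_equality) (use that zmod.subspace_neg[OF Z] in \<open>auto simp: G_simps\<close>)
  interpret B: subgroup B G
    by unfold_locales
      (use B BZ in \<open>auto simp: G_simps inv subset_iff zmod.subspace_add zmod.subspace_0 zmod.subspace_neg\<close>)
  interpret N: normal B G using G.subgroup_imp_normal B.subgroup_axioms by blast
  interpret Q: comm_group "G Mod B" by (rule G.abelian_FactGroup) unfold_locales
  have nat_pow: "x [^]\<^bsub>G\<^esub> k = (\<Sum>i<k. x)" if "x \<in> Z" for x and k :: nat
  proof (induction k)
    case 0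
    show ?case by (simp only: G.nat_pow_0 G_simps lessThan_0 sum.empty)
  next
    case (Suc k)
    then show ?case by (simp only: G.nat_pow_Suc G_simps sum.lessThan_Suc)
  qed
  have int_pow: "x [^]\<^bsub>G\<^esub> k = int_mult k x" if "x \<in> Z" for x and k :: int
  proof (cases "k < 0")
    case True
    have "(\<Sum>i<nat (- k). x) \<in> Z" by (rule zmod.subspace_sum[OF Z that])
    then have "inv\<^bsub>G\<^esub> (\<Sum>i<nat (- k). x) = - (\<Sum>i<nat (- k). x)" by (rule inv)
    then show ?thesis using True that by (simp only: int_pow_def2 nat_pow if_True int_mult_def) simp
  next
    case False
    then show ?thesis using that by (simp only: int_pow_def2 nat_pow if_False int_mult_def) simp
  qed
  have coset_eq: "B #>\<^bsub>G\<^esub> x = B \<longleftrightarrow> x \<in> B" if "x \<in> Z" for x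
    using G.coset_join1[of B x] G.coset_join2[of x B] B.subgroup_axioms that by (auto simp: G_simps)
  have coset_pow: "(B #>\<^bsub>G\<^esub> x) [^]\<^bsub>G Mod B\<^esub> k = B #>\<^bsub>G\<^esub> int_mult k x" if "x \<in> Z" for x and k :: int
    using N.FactGroup_int_pow[of x k] that by (simp add: int_pow G_simps)
  have Z_sum: "(\<Sum>i\<in>I. int_mult (n i) (y i)) \<in> Z" if "y ` I \<subseteq> Z" for I n and y :: "'c \<Rightarrow> 'a"
    by (rule zmod.subspace_sum[OF Z]) (use that in \<open>auto intro: zmod.subspace_scale[OF Z]\<close>)
  have coset_carrier: "B #>\<^bsub>G\<^esub> x \<in> carrier (G Mod B)" if "x \<in> Z" for x
    using that by (auto simp: carrier_FactGroup G_simps)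
  have finprod: "(\<Otimes>\<^bsub>G Mod B\<^esub>i\<in>I. (B #>\<^bsub>G\<^esub> y i) [^]\<^bsub>G Mod B\<^esub> n i) =
      B #>\<^bsub>G\<^esub> (\<Sum>i\<in>I. int_mult (n i) (y i))"
    if "finite I" "y ` I \<subseteq> Z" for I and n :: "'c \<Rightarrow> int" and y
    using that
  proof (induction I rule: finite_induct)
    case empty
    then show ?case using coset_eq[of 0] B.one_closed zmod.subspace_0[OF Z] by (simp add: G_simps)
  next
    case (insert i I)
    have "(\<Otimes>\<^bsub>G Mod B\<^esub>i\<in>insert i I. (B #>\<^bsub>G\<^esub> y i) [^]\<^bsub>G Mod B\<^esub> n i) =
       (B #>\<^bsub>G\<^esub> int_mult (n i) (y i)) <#>\<^bsub>G\<^esub> (B #>\<^bsub>G\<^esub> (\<Sum>i\<in>I. int_mult (n i) (y i)))"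
      using insert coset_carrier
      by (subst Q.finprod_insert) (auto simp: coset_pow intro!: Q.int_pow_closed coset_carrier zmod.subspace_scale[OF Z])
    also have "\<dots> = B #>\<^bsub>G\<^esub> (int_mult (n i) (y i) + (\<Sum>i\<in>I. int_mult (n i) (y i)))"
      using N.rcos_sum[of "int_mult (n i) (y i)" "\<Sum>i\<in>I. int_mult (n i) (y i)"]
        insert Z_sum[of y I n] zmod.subspace_scale[OF Z] by (simp add: G_simps)
    finally show ?case using insert by simp
  qed
  show ?thesis
  proof (rule antisym)
    show "group_rank (G Mod B) \<le> quotient_rank Z B"
      unfolding group_rank_def
    proof (rule SUP_least)
      fix S assume "S \<in> {S. int_independent (G Mod B) S}"
      then have S: "S \<subseteq> carrier (G Mod B)" "finite S"
        "\<And>n s. (\<Otimes>\<^bsub>G Mod B\<^esub>x\<in>S. x [^]\<^bsub>G Mod B\<^esub> (n x :: int)) = B \<Longrightarrow> s \<in> S \<Longrightarrow> n s = 0"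
        by (auto simp: int_independent_def)
      have "\<exists>x. s \<in> S \<longrightarrow> x \<in> Z \<and> s = B #>\<^bsub>G\<^esub> x" for s
        using S(1) by (auto simp: carrier_FactGroup G_simps)
      then obtain y where y: "\<And>s. s \<in> S \<Longrightarrow> y s \<in> Z" "\<And>s. s \<in> S \<Longrightarrow> B #>\<^bsub>G\<^esub> y s = s"
        by metis
      show "enat (card S) \<le> quotient_rank Z B"
      proof (rule quotient_rank_family[where y = y])
        fix n s assume sum: "(\<Sum>i\<in>S. int_mult (n i) (y i)) \<in> B" and s: "s \<in> S"
        have "(\<Otimes>\<^bsub>G Mod B\<^esub>x\<in>S. x [^]\<^bsub>G Mod B\<^esub> n x) =
            (\<Otimes>\<^bsub>G Mod B\<^esub>x\<in>S. (B #>\<^bsub>G\<^esub> y x) [^]\<^bsub>G Mod B\<^esub> n x)"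
          by (rule Q.finprod_cong') (use y S(1) in \<open>auto intro!: Q.int_pow_closed\<close>)
        also have "\<dots> = B #>\<^bsub>G\<^esub> (\<Sum>i\<in>S. int_mult (n i) (y i))"
          by (rule finprod) (use S(2) y(1) in auto)
        also have "\<dots> = B" using coset_eq sum BZ by blast
        finally show "n s = 0" using S(3) s by blast
      qed (use S y B in auto)
    qed
    show "quotient_rank Z B \<le> group_rank (G Mod B)"
    proof (rule quotient_rank_least)
      fix F assume F: "F \<subseteq> Z" "indep_mod B F"
      have fin: "finite F" using F(2) by (simp add: indep_mod_def)
      have inj: "inj_on (\<lambda>x. B #>\<^bsub>G\<^esub> x) F"
      proof (rule inj_onI, rule ccontr)
        fix x y assume xy: "x \<in> F" "y \<in> F" "B #>\<^bsub>G\<^esub> x = B #>\<^bsub>G\<^esub> y" "x \<noteq> y"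
        have "y \<in> B #>\<^bsub>G\<^esub> x"
          using G.repr_independenceD[OF B.subgroup_axioms, of y x] xy F(1) by (auto simp: G_simps)
        then obtain h where h: "h \<in> B" "y = h + x" by (auto simp: r_coset_def G_simps)
        \<comment> \<open>Equal cosets give \<open>h = y - x\<close> in \<open>B\<close>; the
          coefficients -1 and 1 turn this into a nontrivial relation.\<close>
        define n where "n z = (if z = x then - 1 else 0) + (if z = y then 1 else 0 :: int)" for z
        have "(\<Sum>z\<in>F. int_mult (n z) z) = (\<Sum>z\<in>F. (if z = x then - x else 0) + (if z = y then y else 0))"
          by (rule sum.cong) (use xy in \<open>auto simp: n_def\<close>)
        also have "\<dots> = h" using xy fin h by (simp add: sum.distrib)
        finally have "n x = 0" using indep_modD[OF F(2), of n] h xy by simp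
        then show False using xy by (simp add: n_def)
      qed
      have "int_independent (G Mod B) ((\<lambda>x. B #>\<^bsub>G\<^esub> x) ` F)"
        unfolding int_independent_def
      proof (intro conjI allI impI)
        fix n :: "'a set \<Rightarrow> int"
        assume one: "(\<Otimes>\<^bsub>G Mod B\<^esub>x\<in>(\<lambda>x. B #>\<^bsub>G\<^esub> x) ` F. x [^]\<^bsub>G Mod B\<^esub> n x) = \<one>\<^bsub>G Mod B\<^esub>"
        have "(\<Otimes>\<^bsub>G Mod B\<^esub>x\<in>(\<lambda>x. B #>\<^bsub>G\<^esub> x) ` F. x [^]\<^bsub>G Mod B\<^esub> n x) =
            (\<Otimes>\<^bsub>G Mod B\<^esub>x\<in>F. (B #>\<^bsub>G\<^esub> x) [^]\<^bsub>G Mod B\<^esub> n (B #>\<^bsub>G\<^esub> x))"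
          by (rule Q.finprod_reindex) (use F(1) coset_carrier inj in \<open>auto intro!: Q.int_pow_closed\<close>)
        also have "\<dots> = B #>\<^bsub>G\<^esub> (\<Sum>x\<in>F. int_mult (n (B #>\<^bsub>G\<^esub> x)) x)"
          using finprod[of F "\<lambda>x. x" "\<lambda>x. n (B #>\<^bsub>G\<^esub> x)"] fin F(1) by simp
        finally have "B #>\<^bsub>G\<^esub> (\<Sum>x\<in>F. int_mult (n (B #>\<^bsub>G\<^esub> x)) x) = B"
          using one by simp
        moreover have "(\<Sum>x\<in>F. int_mult (n (B #>\<^bsub>G\<^esub> x)) x) \<in> Z" by (rule Z_sum) (use F(1) in simp)
        ultimately have "(\<Sum>x\<in>F. int_mult (n (B #>\<^bsub>G\<^esub> x)) x) \<in> B" using coset_eq by blast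
        then have "\<forall>x\<in>F. n (B #>\<^bsub>G\<^esub> x) = 0" by (rule indep_modD[OF F(2)])
        then show "\<forall>x\<in>(\<lambda>x. B #>\<^bsub>G\<^esub> x) ` F. n x = 0" by blast
      qed (use F(1) fin coset_carrier in auto)
      then have "enat (card ((\<lambda>x. B #>\<^bsub>G\<^esub> x) ` F)) \<le> group_rank (G Mod B)"
        unfolding group_rank_def by (intro SUP_upper) simp
      then show "enat (card F) \<le> group_rank (G Mod B)" using card_image[OF inj] by simp
    qed
  qed
qed

section \<open>The rank count in a triple of chain complexes\<close>

text \<open>All degrees share one type; the grading lives in the families of subsets to which the
  maps are applied.\<close>

locale boundary_maps =
  fixes d :: "nat \<Rightarrow> 'b::ab_group_add \<Rightarrow> 'b"
  assumes additive_d: "Modules.additive (d p)"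
    and d_0 [simp]: "d 0 x = 0"
begin

lemma d_diff: "d p (x - y) = d p x - d p y"
  by (rule additive.diff[OF additive_d])

lemma d_zero [simp]: "d p 0 = 0"
  by (rule additive.zero[OF additive_d])

text \<open>That the boundary squares to zero is asked only on members of \<open>C\<close>, the form
  in which \<open>coeff_boundary_boundary\<close> supplies it.\<close>

definition subcomplex :: "(nat \<Rightarrow> 'b set) \<Rightarrow> bool" where
  "subcomplex C \<longleftrightarrow> (\<forall>p. add_subgroup (C p)) \<and> (\<forall>p. d p ` C p \<subseteq> C (p - 1)) \<and>
     (\<forall>p. \<forall>x \<in> C (Suc p). d p (d (Suc p) x) = 0)"

text \<open>In degree 0 the truncated \<open>p - 1\<close> does no harm: \<open>d 0 c = 0\<close>
  lies in every subgroup.\<close>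

definition relcycles :: "(nat \<Rightarrow> 'b set) \<Rightarrow> (nat \<Rightarrow> 'b set) \<Rightarrow> nat \<Rightarrow> 'b set" where
  "relcycles C E p = {c \<in> C p. d p c \<in> E (p - 1)}"

text \<open>Contains \<open>E p\<close> itself, by taking the chain 0. Hence for \<open>E\<close>
  inside \<open>C\<close> the group of \<open>relcycles\<close> modulo \<open>relboundaries\<close>
  is the homology of C/E, although no quotient complex is formed.\<close>

definition relboundaries :: "(nat \<Rightarrow> 'b set) \<Rightarrow> (nat \<Rightarrow> 'b set) \<Rightarrow> nat \<Rightarrow> 'b set" where
  "relboundaries C E p = {c. \<exists>x \<in> C (Suc p). d (Suc p) x - c \<in> E p}"

definition betti :: "(nat \<Rightarrow> 'b set) \<Rightarrow> (nat \<Rightarrow> 'b set) \<Rightarrow> nat \<Rightarrow> enat" where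
  "betti C E p = quotient_rank (relcycles C E p) (relboundaries C E p)"

lemma add_subgroup_relcycles:
  assumes "subcomplex C" "subcomplex E"
  shows "add_subgroup (relcycles C E p)"
  using assms
  by (intro add_subgroupI)
     (auto simp: relcycles_def subcomplex_def d_diff zmod.subspace_0 zmod.subspace_diff)

lemma relboundaries_diff:
  assumes "subcomplex C" "subcomplex E" "x \<in> relboundaries C E p" "y \<in> relboundaries C E p"
  shows "x - y \<in> relboundaries C E p"
proof -
  obtain u v where uv: "u \<in> C (Suc p)" "d (Suc p) u - x \<in> E p" "v \<in> C (Suc p)" "d (Suc p) v - y \<in> E p"
    using assms by (auto simp: relboundaries_def)
  have "d (Suc p) (u - v) - (x - y) = (d (Suc p) u - x) - (d (Suc p) v - y)"
    by (simp add: d_diff)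
  also have "\<dots> \<in> E p" using uv assms(2) by (simp add: subcomplex_def zmod.subspace_diff)
  finally show ?thesis
    using uv assms(1) unfolding relboundaries_def
    by (auto simp: subcomplex_def intro!: bexI[of _ "u - v"] zmod.subspace_diff)
qed

lemma subset_relboundaries:
  assumes "subcomplex C" "subcomplex E" "x \<in> E p"
  shows "x \<in> relboundaries C E p"
  using assms unfolding relboundaries_def
  by (auto simp: subcomplex_def zmod.subspace_0 zmod.subspace_neg intro!: bexI[of _ 0])

lemma boundary_relboundaries:
  assumes "subcomplex E" "x \<in> C (Suc p)"
  shows "d (Suc p) x \<in> relboundaries C E p"
  using assms unfolding relboundaries_def
  by (auto simp: subcomplex_def zmod.subspace_0 intro!: bexI[of _ x])

lemma add_subgroup_relboundaries:
  assumes "subcomplex C" "subcomplex E"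
  shows "add_subgroup (relboundaries C E p)"
  using assms relboundaries_diff[OF assms] subset_relboundaries[OF assms, of 0 p]
  by (intro add_subgroupI) (auto simp: subcomplex_def zmod.subspace_0)

lemma relboundaries_subset_relcycles:
  assumes C: "subcomplex C" and E: "subcomplex E" and EC: "\<And>p. E p \<subseteq> C p"
  shows "relboundaries C E p \<subseteq> relcycles C E p"
proof
  fix c assume "c \<in> relboundaries C E p"
  then obtain x where x: "x \<in> C (Suc p)" and e: "d (Suc p) x - c \<in> E p"
    by (auto simp: relboundaries_def)
  have "d (Suc p) x \<in> C p" using C x by (force simp: subcomplex_def)
  moreover have "d (Suc p) x - c \<in> C p" using e EC by blast
  ultimately have "c \<in> C p"
    using zmod.subspace_diff[of "C p" "d (Suc p) x" "d (Suc p) x - c"] C by (simp add: subcomplex_def)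
  have "d p c = - d p (d (Suc p) x - c)"
    using C x by (simp add: d_diff subcomplex_def)
  moreover have "d p (d (Suc p) x - c) \<in> E (p - 1)"
    using E e unfolding subcomplex_def by blast
  ultimately have "d p c \<in> E (p - 1)"
    using E zmod.subspace_neg[of "E (p - 1)" "d p (d (Suc p) x - c)"] by (simp add: subcomplex_def)
  with \<open>c \<in> C p\<close> show "c \<in> relcycles C E p" by (simp add: relcycles_def)
qed

lemma betti_eq_0:
  assumes "subcomplex C" "subcomplex E" "\<And>p. E p \<subseteq> C p"
    and "relcycles C E p \<subseteq> relboundaries C E p"
  shows "betti C E p = 0"
  using quotient_rank_self[OF add_subgroup_relcycles[OF assms(1,2), of p]]
    relboundaries_subset_relcycles[OF assms(1-3), of p] assms(4)
  by (simp add: betti_def subset_antisym)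

text \<open>In the long exact sequence of the triple, \<open>r p\<close> is the rank of the connecting homomorphism
  from degree \<open>p + 1\<close> to degree \<open>p\<close>.\<close>

theorem betti_triple:
  assumes C: "subcomplex C" and D: "subcomplex D" and E: "subcomplex E"
    and DC: "\<And>p. D p \<subseteq> C p" and ED: "\<And>p. E p \<subseteq> D p"
  obtains r where
    "\<And>p. betti D E p + betti C D p = betti C E p + r p + (if p = 0 then 0 else r (p - 1))"
    "\<And>p. r p \<le> betti D E p" "\<And>p. r p \<le> betti C D (Suc p)"
proof
  have EC: "E p \<subseteq> C p" for p using DC ED by blast
  have id: "Modules.additive (\<lambda>x::'b. x)" by unfold_locales simp
  note sub = add_subgroup_relcycles[OF C D] add_subgroup_relcycles[OF C E] add_subgroup_relcycles[OF D E]
    add_subgroup_relboundaries[OF C D] add_subgroup_relboundaries[OF C E] add_subgroup_relboundaries[OF D E]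
  have ZDE_ZCE: "relcycles D E p \<subseteq> relcycles C E p" for p
    using DC by (auto simp: relcycles_def)
  have BDE_BCE: "relboundaries D E p \<subseteq> relboundaries C E p" for p
    using DC by (auto simp: relboundaries_def)
  have BCE_BCD: "relboundaries C E p \<subseteq> relboundaries C D p" for p
    using ED by (auto simp: relboundaries_def)
  \<comment> \<open>Kernels in the long exact sequence, lifted to chains: the group in
    \<open>r p\<close> is that of H_p(D,E) -> H_p(C,E), \<open>W p\<close> that of H_p(C,E) ->
    H_p(C,D), and \<open>U p\<close> that of the connecting map on H_p(C,D).\<close>
  define r where "r p = quotient_rank (relcycles D E p \<inter> relboundaries C E p) (relboundaries D E p)" for p
  define W where "W p = relcycles C E p \<inter> relboundaries C D p" for p
  define U where "U p = {c \<in> relcycles C D p. d p c \<in> relboundaries D E (p - 1)}" for p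
  have subW: "add_subgroup (W p)" for p by (simp add: W_def sub zmod.subspace_inter)
  have subU: "add_subgroup (U p)" for p
    unfolding U_def using sub(1)[of p] sub(6)[of "p - 1"]
    by (intro add_subgroupI) (auto simp: d_diff zmod.subspace_0 zmod.subspace_diff)
  \<comment> \<open>Each Betti number splits into the rank of the outgoing image and the rank of the
    kernel. The facts \<open>1\<close>, \<open>2\<close> and \<open>3\<close> below match every
    image with the next kernel, which is exactness.\<close>
  have ZCE: "betti C E p = quotient_rank (relcycles C E p) (W p) + quotient_rank (W p) (relboundaries C E p)" for p
    unfolding betti_def
    by (rule quotient_rank_add)
       (use sub subW BCE_BCD[of p] relboundaries_subset_relcycles[OF C E EC, of p] in \<open>auto simp: W_def\<close>)
  have ZDE: "betti D E p = quotient_rank (relcycles D E p) (relcycles D E p \<inter> relboundaries C E p) + r p" for p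
    unfolding betti_def r_def
    by (rule quotient_rank_add)
       (use sub BDE_BCE[of p] relboundaries_subset_relcycles[OF D E ED, of p] in
        \<open>auto intro: zmod.subspace_inter\<close>)
  have BCD_U: "relboundaries C D p \<subseteq> U p" for p
  proof
    fix c assume c: "c \<in> relboundaries C D p"
    then obtain x where x: "x \<in> C (Suc p)" "d (Suc p) x - c \<in> D p" by (auto simp: relboundaries_def)
    have dc: "d p (c - d (Suc p) x) = d p c" using C x by (simp add: d_diff subcomplex_def)
    have cD: "c - d (Suc p) x \<in> D p"
      using zmod.subspace_neg[of "D p" "d (Suc p) x - c"] D x by (simp add: subcomplex_def)
    have "d p c \<in> relboundaries D E (p - 1)"
    proof (cases p)
      case 0
      then show ?thesis using zmod.subspace_0[OF sub(6)] by simp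
    next
      case (Suc q)
      then show ?thesis using boundary_relboundaries[OF E, of "c - d (Suc p) x" D q] cD dc by simp
    qed
    then show "c \<in> U p"
      using c relboundaries_subset_relcycles[OF C D DC, of p] by (auto simp: U_def)
  qed
  have ZCD: "betti C D p = quotient_rank (relcycles C D p) (U p) + quotient_rank (U p) (relboundaries C D p)" for p
    unfolding betti_def
    by (rule quotient_rank_add) (use sub subU BCD_U[of p] in \<open>auto simp: U_def\<close>)
  \<comment> \<open>Exactness at H_p(C,E): an element of \<open>W p\<close> differs by the boundary
    of a chain of \<open>C\<close> from a relative cycle in \<open>D\<close>.\<close>
  have 1: "quotient_rank (relcycles D E p) (relcycles D E p \<inter> relboundaries C E p) =
      quotient_rank (W p) (relboundaries C E p)" for p
  proof (rule quotient_rank_iso[OF id])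
    fix z assume z: "z \<in> relcycles D E p"
    then show "z \<in> W p"
      using ZDE_ZCE subset_relboundaries[OF C D] by (auto simp: W_def relcycles_def)
  next
    fix w assume w: "w \<in> W p"
    then obtain x where x: "x \<in> C (Suc p)" "d (Suc p) x - w \<in> D p"
      by (auto simp: W_def relboundaries_def)
    have "w - d (Suc p) x \<in> D p"
      using zmod.subspace_neg[of "D p" "d (Suc p) x - w"] D x by (simp add: subcomplex_def)
    moreover have "d p (w - d (Suc p) x) = d p w" using C x by (simp add: d_diff subcomplex_def)
    ultimately have "w - d (Suc p) x \<in> relcycles D E p" using w by (auto simp: relcycles_def W_def)
    moreover have "w - (w - d (Suc p) x) \<in> relboundaries C E p"
      using boundary_relboundaries[OF E, of x C p] x(1) by simp
    ultimately show "\<exists>z\<in>relcycles D E p. w - z \<in> relboundaries C E p" by blast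
  qed (use sub in \<open>auto intro: zmod.subspace_inter\<close>)
  \<comment> \<open>Exactness at H_p(C,D): if the boundary of \<open>u\<close> bounds in
    \<open>D\<close> modulo \<open>E\<close>, subtracting that chain \<open>y\<close> of
    \<open>D\<close> makes \<open>u\<close> a cycle relative to \<open>E\<close>.\<close>
  have 2: "quotient_rank (relcycles C E p) (W p) = quotient_rank (U p) (relboundaries C D p)" for p
  proof (rule quotient_rank_iso[OF id])
    fix z assume "z \<in> relcycles C E p"
    then show "z \<in> U p"
      using ED subset_relboundaries[OF D E] by (auto simp: U_def relcycles_def)
  next
    fix u assume u: "u \<in> U p"
    have "\<exists>y \<in> D p. d p (u - y) \<in> E (p - 1)"
    proof (cases p)
      case 0
      have "0 \<in> D p" "0 \<in> E (p - 1)" using D E by (auto simp: subcomplex_def zmod.subspace_0)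
      then show ?thesis using 0 by auto
    next
      case (Suc q)
      then obtain y where y: "y \<in> D p" "d p y - d p u \<in> E q"
        using u by (auto simp: U_def relboundaries_def)
      then have "d p (u - y) \<in> E (p - 1)"
        using zmod.subspace_neg[of "E q" "d p y - d p u"] E Suc by (simp add: subcomplex_def d_diff)
      then show ?thesis using y by blast
    qed
    then obtain y where y: "y \<in> D p" "d p (u - y) \<in> E (p - 1)" by blast
    then have "u - y \<in> C p"
      using C DC u by (auto simp: subcomplex_def U_def relcycles_def intro!: zmod.subspace_diff)
    then have "u - y \<in> relcycles C E p" using y by (simp add: relcycles_def)
    moreover have "u - (u - y) \<in> relboundaries C D p" using subset_relboundaries[OF C D y(1)] by simp
    ultimately show "\<exists>z\<in>relcycles C E p. u - z \<in> relboundaries C D p" by blast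
  qed (use sub subW in \<open>auto simp: W_def\<close>)
  \<comment> \<open>Exactness at H_q(D,E): the boundary operator itself induces the isomorphism, so
    \<open>quotient_rank_iso\<close> is used with a map other than the identity.\<close>
  have 3: "quotient_rank (relcycles C D (Suc q)) (U (Suc q)) = r q" for q
    unfolding r_def
  proof (rule quotient_rank_iso[OF additive_d[of "Suc q"]])
    fix z assume "z \<in> relcycles C D (Suc q)"
    then show "d (Suc q) z \<in> relcycles D E q \<inter> relboundaries C E q"
      using boundary_relboundaries[OF E, of z C q] C E
      by (auto simp: relcycles_def subcomplex_def zmod.subspace_0)
  next
    fix z' assume z': "z' \<in> relcycles D E q \<inter> relboundaries C E q"
    then obtain x where x: "x \<in> C (Suc q)" "d (Suc q) x - z' \<in> E q"
      by (auto simp: relboundaries_def)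
    have "d (Suc q) x - z' + z' \<in> D q"
      using D x(2) ED z' by (intro zmod.subspace_add) (auto simp: subcomplex_def relcycles_def)
    then have "x \<in> relcycles C D (Suc q)" using x by (simp add: relcycles_def)
    moreover have "z' - d (Suc q) x \<in> E q"
      using zmod.subspace_neg[of "E q" "d (Suc q) x - z'"] E x by (simp add: subcomplex_def)
    then have "z' - d (Suc q) x \<in> relboundaries D E q" by (rule subset_relboundaries[OF D E])
    ultimately show "\<exists>z\<in>relcycles C D (Suc q). z' - d (Suc q) z \<in> relboundaries D E q" by blast
  qed (use sub subU[of "Suc q"] in \<open>auto simp: U_def\<close>)
  \<comment> \<open>No connecting map leaves degree 0, which explains the exceptional term for
    \<open>p = 0\<close>.\<close>
  have "U 0 = relcycles C D 0" using zmod.subspace_0[OF sub(6)] by (auto simp: U_def)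
  then have 4: "quotient_rank (relcycles C D p) (U p) = (if p = 0 then 0 else r (p - 1))" for p
    using 3 quotient_rank_self[OF sub(1)] by (cases p) auto
  show "betti D E p + betti C D p = betti C E p + r p + (if p = 0 then 0 else r (p - 1))" for p
    unfolding ZCE ZDE ZCD 1 2 4 by (simp only: ac_simps)
  show "r p \<le> betti D E p" for p unfolding ZDE by simp
  show "r p \<le> betti C D (Suc p)" for p unfolding ZCD 3 by simp
qed

text \<open>If H(C,D) vanishes, so do all connecting ranks, being bounded by it. The triple equation
  then collapses without subtracting possibly infinite ranks.\<close>

lemma betti_cancel_upper:
  assumes "subcomplex C" "subcomplex D" "subcomplex E" "\<And>p. D p \<subseteq> C p" "\<And>p. E p \<subseteq> D p"
    and "\<And>p. betti C D p = 0"
  shows "betti C E p = betti D E p"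
proof -
  obtain r where "\<And>p. betti D E p + betti C D p = betti C E p + r p + (if p = 0 then 0 else r (p - 1))"
    "\<And>p. r p \<le> betti C D (Suc p)"
    using betti_triple[OF assms(1-5)] by metis
  then show ?thesis using assms(6) by (metis add.right_neutral le_zero_eq)
qed

text \<open>Here the connecting ranks vanish through the other bound, by the Betti numbers of
  (D,E).\<close>

lemma betti_cancel_lower:
  assumes "subcomplex C" "subcomplex D" "subcomplex E" "\<And>p. D p \<subseteq> C p" "\<And>p. E p \<subseteq> D p"
    and "\<And>p. betti D E p = 0"
  shows "betti C E p = betti C D p"
proof -
  obtain r where "\<And>p. betti D E p + betti C D p = betti C E p + r p + (if p = 0 then 0 else r (p - 1))"
    "\<And>p. r p \<le> betti D E p"
    using betti_triple[OF assms(1-5)] by metis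
  then show ?thesis using assms(6) by (metis add.right_neutral add_0 le_zero_eq)
qed

end

section \<open>Change of coefficients in singular homology\<close>

text \<open>The elementary tensor of \<open>z\<close> and \<open>g\<close>, with the tensor product
  of a free group and \<open>'g\<close> seen as the finitely supported \<open>'g\<close>-valued
  functions on the basis.\<close>

definition coeff_tensor :: "('b \<Rightarrow>\<^sub>0 int) \<Rightarrow> 'g::ab_group_add \<Rightarrow> ('b \<Rightarrow>\<^sub>0 'g)" where
  "coeff_tensor z g = Poly_Mapping.map (\<lambda>n. int_mult n g) z"

lemma lookup_coeff_tensor [simp]:
  "Poly_Mapping.lookup (coeff_tensor z g) x = int_mult (Poly_Mapping.lookup z x) g"
  by (simp add: coeff_tensor_def Poly_Mapping.map.rep_eq when_def)

lemma keys_coeff_tensor: "Poly_Mapping.keys (coeff_tensor z g) \<subseteq> Poly_Mapping.keys z"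
  by (auto simp: in_keys_iff)

lemma coeff_tensor_0_left [simp]: "coeff_tensor 0 g = 0"
  and coeff_tensor_0_right [simp]: "coeff_tensor z 0 = 0"
  and coeff_tensor_add_left: "coeff_tensor (y + z) g = coeff_tensor y g + coeff_tensor z g"
  and coeff_tensor_diff_left: "coeff_tensor (y - z) g = coeff_tensor y g - coeff_tensor z g"
  and coeff_tensor_add_right: "coeff_tensor z (g + h) = coeff_tensor z g + coeff_tensor z h"
  and coeff_tensor_int_mult: "coeff_tensor z (int_mult n g) = coeff_tensor (frag_cmul n z) g"
  and coeff_tensor_frag_of [simp]: "coeff_tensor (frag_of x) g = Poly_Mapping.single x g"
  by (rule poly_mapping_eqI;
      simp add: lookup_add lookup_minus lookup_single when_def zmod.scale_right_distrib
        zmod.scale_left_distrib zmod.scale_left_diff_distrib mult.commute)+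

lemma coeff_tensor_sum_left: "coeff_tensor (\<Sum>i\<in>I. f i) g = (\<Sum>i\<in>I. coeff_tensor (f i) g)"
  by (induction I rule: infinite_finite_induct) (simp_all add: coeff_tensor_add_left)

text \<open>This is \<open>F \<otimes> id\<close> on \<open>C \<otimes> G\<close>.\<close>

definition coeff_extend ::
    "('a \<Rightarrow> 'b \<Rightarrow>\<^sub>0 int) \<Rightarrow> ('a \<Rightarrow>\<^sub>0 'g::ab_group_add) \<Rightarrow> ('b \<Rightarrow>\<^sub>0 'g)" where
  "coeff_extend F c = (\<Sum>x\<in>Poly_Mapping.keys c. coeff_tensor (F x) (Poly_Mapping.lookup c x))"

lemma coeff_extend_superset:
  assumes "finite K" "Poly_Mapping.keys c \<subseteq> K"
  shows "coeff_extend F c = (\<Sum>x\<in>K. coeff_tensor (F x) (Poly_Mapping.lookup c x))"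
  unfolding coeff_extend_def
  by (rule sum.mono_neutral_left) (use assms in \<open>auto simp: in_keys_iff\<close>)

lemma additive_coeff_extend:
  fixes F :: "'a \<Rightarrow> 'b \<Rightarrow>\<^sub>0 int"
  shows "Modules.additive (coeff_extend F :: ('a \<Rightarrow>\<^sub>0 'g::ab_group_add) \<Rightarrow> _)"
proof
  fix a b :: "'a \<Rightarrow>\<^sub>0 'g"
  let ?K = "Poly_Mapping.keys a \<union> Poly_Mapping.keys b"
  show "coeff_extend F (a + b) = coeff_extend F a + coeff_extend F b"
    by (simp add: coeff_extend_superset[of ?K] keys_add lookup_add coeff_tensor_add_right sum.distrib)
qed

lemma coeff_extend_tensor: "coeff_extend F (coeff_tensor z g) = coeff_tensor (frag_extend F z) g"
  by (simp add: coeff_extend_superset[OF _ keys_coeff_tensor] coeff_tensor_int_mult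
      frag_extend_def coeff_tensor_sum_left)

text \<open>Functoriality of tensoring: identities between composites over \<open>'g\<close> reduce
  to integral identities on single simplices.\<close>

lemma coeff_extend_coeff_extend:
  "coeff_extend F (coeff_extend F' c) = coeff_extend (\<lambda>x. frag_extend F (F' x)) c"
  unfolding coeff_extend_def[of F'] additive.sum[OF additive_coeff_extend] coeff_extend_tensor
  unfolding coeff_extend_def ..

lemma coeff_extend_add: "coeff_extend F c + coeff_extend F' c = coeff_extend (\<lambda>x. F x + F' x) c"
  and coeff_extend_diff: "coeff_extend F c - coeff_extend F' c = coeff_extend (\<lambda>x. F x - F' x) c"
  by (simp_all add: coeff_extend_def coeff_tensor_add_left coeff_tensor_diff_left
      sum.distrib sum_subtractf)

lemma coeff_extend_eq_0:
  assumes "\<And>x. x \<in> Poly_Mapping.keys c \<Longrightarrow> F x = 0"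
  shows "coeff_extend F c = 0"
  using assms by (simp add: coeff_extend_def)

lemma coeff_extend_frag_of: "coeff_extend frag_of c = c"
  by (rule poly_mapping_eqI) (simp add: coeff_extend_def lookup_sum lookup_single when_def in_keys_iff)

lemma coeff_singular_chain_extend:
  assumes "coeff_singular_chain p X c"
    and "\<And>\<sigma>. singular_simplex p X \<sigma> \<Longrightarrow> singular_chain q Y (F \<sigma>)"
  shows "coeff_singular_chain q Y (coeff_extend F c)"
proof -
  have "Poly_Mapping.keys (coeff_extend F c) \<subseteq> (\<Union>x\<in>Poly_Mapping.keys c. Poly_Mapping.keys (F x))"
    unfolding coeff_extend_def
    by (rule order_trans[OF keys_sum]) (intro UN_mono order_refl keys_coeff_tensor)
  then show ?thesis
    using assms unfolding coeff_singular_chain_def singular_chain_def by blast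
qed

lemma chain_boundary_frag_extend:
  "chain_boundary p z = frag_extend (\<lambda>\<sigma>. chain_boundary p (frag_of \<sigma>)) z"
  by (cases "p = 0") (simp_all add: chain_boundary_def frag_extend_eq_0)

text \<open>The boundary over \<open>'g\<close> is the integral boundary tensored with the identity,
  since a sign may sit on the face or on the coefficient. Facts on integral chains become available
  through this.\<close>

lemma coeff_boundary_extend:
  "coeff_boundary p c = coeff_extend (\<lambda>\<sigma>. chain_boundary p (frag_of \<sigma>)) c"
proof (cases "p = 0")
  case True
  then show ?thesis by (simp add: coeff_boundary_def chain_boundary_def coeff_extend_def)
next
  case False
  have sign: "coeff_tensor (frag_cmul ((-1) ^ k) (frag_of s)) g =
      Poly_Mapping.single s (if even k then g else - g)" for k s and g :: 'b
    by (rule poly_mapping_eqI) (simp add: lookup_single when_def)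
  then show ?thesis
    using False
    by (simp add: coeff_boundary_def coeff_extend_def chain_boundary_of coeff_tensor_sum_left sign)
qed

lemma coeff_boundary_boundary:
  assumes "coeff_singular_chain (Suc p) X c"
  shows "coeff_boundary p (coeff_boundary (Suc p) c) = 0"
  unfolding coeff_boundary_extend coeff_extend_coeff_extend
proof (rule coeff_extend_eq_0)
  fix \<sigma> assume "\<sigma> \<in> Poly_Mapping.keys c"
  then have "singular_chain (Suc p) X (frag_of \<sigma>)"
    using assms by (auto simp: coeff_singular_chain_def singular_chain_of)
  then show "frag_extend (\<lambda>\<sigma>. chain_boundary p (frag_of \<sigma>)) (chain_boundary (Suc p) (frag_of \<sigma>)) = 0"
    using chain_boundary_boundary_alt chain_boundary_frag_extend by metis
qed

section \<open>The singular chain complex with coefficients\<close>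

interpretation coeff: boundary_maps coeff_boundary
proof
  show "coeff_boundary p (x + y) = coeff_boundary p x + coeff_boundary p y"
    for p and x y :: "('a, 'b) coeff_chain"
    unfolding coeff_boundary_extend by (rule additive.add[OF additive_coeff_extend])
qed (simp add: coeff_boundary_def)

abbreviation coeff_chains :: "'a topology \<Rightarrow> nat \<Rightarrow> ('a, 'g::ab_group_add) coeff_chain set" where
  "coeff_chains X p \<equiv> {c. coeff_singular_chain p X c}"

lemma coeff_singular_chain_0 [simp]: "coeff_singular_chain p X 0"
  by (simp add: coeff_singular_chain_def)

lemma coeff_singular_chain_diff:
  "coeff_singular_chain p X x \<Longrightarrow> coeff_singular_chain p X y \<Longrightarrow> coeff_singular_chain p X (x - y)"
  unfolding coeff_singular_chain_def using keys_diff[of x y] by blast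

lemma coeff_singular_chain_mono:
  "coeff_singular_chain p (subtopology X A) c \<Longrightarrow> coeff_singular_chain p X c"
  unfolding coeff_singular_chain_def by (auto simp: singular_simplex_subtopology)

lemma subcomplex_coeff_chains:
  "coeff.subcomplex (coeff_chains X :: nat \<Rightarrow> ('a, 'g::ab_group_add) coeff_chain set)"
  unfolding coeff.subcomplex_def
proof (intro conjI allI)
  show "add_subgroup (coeff_chains X p :: ('a, 'g) coeff_chain set)" for p
    by (rule add_subgroupI) (auto intro: coeff_singular_chain_diff)
  show "coeff_boundary p ` coeff_chains X p \<subseteq> (coeff_chains X (p - 1) :: ('a, 'g) coeff_chain set)" for p
  proof (intro image_subsetI CollectI)
    fix c :: "('a, 'g) coeff_chain" assume "c \<in> coeff_chains X p"
    then show "coeff_singular_chain (p - 1) X (coeff_boundary p c)"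
      unfolding coeff_boundary_extend
      by (intro coeff_singular_chain_extend[where p = p])
         (auto intro: singular_chain_boundary simp: singular_chain_of)
  qed
  show "\<forall>c\<in>coeff_chains X (Suc p). coeff_boundary p (coeff_boundary (Suc p) c) = (0 :: ('a, 'g) coeff_chain)" for p
    using coeff_boundary_boundary by blast
qed

lemma group_rank_coeff_relative_homology_group:
  "group_rank (coeff_relative_homology_group p X A :: ('a, 'g::ab_group_add) coeff_chain set monoid) =
     coeff.betti (coeff_chains X :: nat \<Rightarrow> ('a, 'g) coeff_chain set) (coeff_chains (subtopology X A)) p"
proof -
  have Z: "coeff_relcycles p X A =
      (coeff.relcycles (coeff_chains X) (coeff_chains (subtopology X A)) p :: ('a, 'g) coeff_chain set)"
    unfolding coeff_relcycles_def coeff.relcycles_def mem_Collect_eq ..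
  have B: "coeff_relboundaries p X A =
      (coeff.relboundaries (coeff_chains X) (coeff_chains (subtopology X A)) p :: ('a, 'g) coeff_chain set)"
    unfolding coeff_relboundaries_def coeff.relboundaries_def mem_Collect_eq Bex_def ..
  have sub: "coeff_chains (subtopology X A) p \<subseteq> (coeff_chains X p :: ('a, 'g) coeff_chain set)" for p
    by (auto intro: coeff_singular_chain_mono)
  show ?thesis
    unfolding coeff_relative_homology_group_def coeff_relcycle_group_def coeff.betti_def Z B
    by (intro group_rank_Mod coeff.add_subgroup_relcycles coeff.add_subgroup_relboundaries
        coeff.relboundaries_subset_relcycles subcomplex_coeff_chains sub)
qed

text \<open>The relative singular chain complex is free, so if it is acyclic over the integers, then
  it has a contracting homotopy, which survives tensoring with the coefficient group.\<close>

lemma coeff_relcycles_subset_relboundaries: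
  assumes acyclic: "\<And>p c. singular_relcycle p X A c \<Longrightarrow> singular_relboundary p X A c"
  shows "coeff_relcycles p X A \<subseteq> (coeff_relboundaries p X A :: ('a, 'g::ab_group_add) coeff_chain set)"
proof -
  let ?XA = "subtopology X A"
  \<comment> \<open>The invariant of one degree of the contraction. Vanishing on simplices of
    \<open>A\<close> is demanded exactly, not only modulo \<open>A\<close>, so that it survives
    tensoring. The last clause, on absolute cycles, is what the next degree needs for boundaries of
    simplices.\<close>
  define P where "P p s \<longleftrightarrow>
      (\<forall>\<sigma>. singular_simplex p X \<sigma> \<longrightarrow> singular_chain (Suc p) X (s \<sigma>)) \<and>
      (\<forall>\<sigma>. singular_simplex p ?XA \<sigma> \<longrightarrow> s \<sigma> = 0) \<and>
      (\<forall>z. singular_chain p X z \<and> chain_boundary p z = 0 \<longrightarrow>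
         singular_chain p ?XA (chain_boundary (Suc p) (frag_extend s z) - z))"
    for p :: nat and s :: "((nat \<Rightarrow> real) \<Rightarrow> 'a) \<Rightarrow> 'a chain"
  \<comment> \<open>The homotopy identity on generators: modulo chains in \<open>A\<close>, the
    boundary of \<open>s'\<close> plus \<open>s\<close> of the boundary is the identity.\<close>
  define Q where "Q p s s' \<longleftrightarrow>
      (\<forall>\<sigma>. singular_simplex (Suc p) X \<sigma> \<longrightarrow>
         singular_chain (Suc p) ?XA (chain_boundary (Suc (Suc p)) (s' \<sigma>) +
           frag_extend s (chain_boundary (Suc p) (frag_of \<sigma>)) - frag_of \<sigma>))"
    for p :: nat and s s' :: "((nat \<Rightarrow> real) \<Rightarrow> 'a) \<Rightarrow> 'a chain"
  have pick: "\<exists>d. singular_chain (Suc p) X d \<and> singular_chain p ?XA (chain_boundary (Suc p) d - z)"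
    if "singular_chain p X z" "singular_chain (p - 1) ?XA (chain_boundary p z)" for p z
    using acyclic[of p z] that
    by (auto simp: singular_relcycle_def singular_relboundary_def mod_subset_def)
  have "\<exists>s. \<forall>p. P p (s p) \<and> Q p (s p) (s (Suc p))"
  proof (rule dependent_nat_choice)
    have "\<exists>d. singular_simplex 0 X \<sigma> \<longrightarrow> singular_chain (Suc 0) X d \<and>
        singular_chain 0 ?XA (chain_boundary (Suc 0) d - frag_of \<sigma>) \<and>
        (singular_simplex 0 ?XA \<sigma> \<longrightarrow> d = 0)" for \<sigma>
    proof (cases "singular_simplex 0 X \<sigma> \<and> \<not> singular_simplex 0 ?XA \<sigma>")
      case True
      then show ?thesis
        using pick[of 0 "frag_of \<sigma>"] by (auto simp: singular_chain_of chain_boundary_of)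
    next
      case False
      then show ?thesis
        by (auto simp: singular_chain_of singular_chain_minus intro!: exI[of _ 0])
    qed
    then obtain s where s: "\<And>\<sigma>. singular_simplex 0 X \<sigma> \<Longrightarrow> singular_chain (Suc 0) X (s \<sigma>)"
      "\<And>\<sigma>. singular_simplex 0 X \<sigma> \<Longrightarrow> singular_chain 0 ?XA (chain_boundary (Suc 0) (s \<sigma>) - frag_of \<sigma>)"
      "\<And>\<sigma>. singular_simplex 0 X \<sigma> \<Longrightarrow> singular_simplex 0 ?XA \<sigma> \<Longrightarrow> s \<sigma> = 0"
      by metis
    have "singular_chain 0 ?XA (chain_boundary (Suc 0) (frag_extend s z) - z)" if "singular_chain 0 X z" for z
      using that[unfolded singular_chain_def]
    proof (induction z rule: frag_induction)
      case (diff a b)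
      have "chain_boundary (Suc 0) (frag_extend s (a - b)) - (a - b) =
          (chain_boundary (Suc 0) (frag_extend s a) - a) - (chain_boundary (Suc 0) (frag_extend s b) - b)"
        by (simp add: frag_extend_diff chain_boundary_diff)
      then show ?case using diff singular_chain_diff by metis
    qed (use s(2) in auto)
    then have "P 0 s"
      using s by (auto simp: P_def singular_simplex_subtopology)
    then show "\<exists>s. P 0 s" by (rule exI[where x = s])
  next
    fix s p assume s: "P p s"
    have "\<exists>d. singular_simplex (Suc p) X \<sigma> \<longrightarrow> singular_chain (Suc (Suc p)) X d \<and>
        singular_chain (Suc p) ?XA (chain_boundary (Suc (Suc p)) d +
           frag_extend s (chain_boundary (Suc p) (frag_of \<sigma>)) - frag_of \<sigma>) \<and>
        (singular_simplex (Suc p) ?XA \<sigma> \<longrightarrow> d = 0)" for \<sigma>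
    proof (cases "singular_simplex (Suc p) X \<sigma>")
      case \<sigma>: True
      \<comment> \<open>By the last clause of \<open>P\<close>, applied to the cycle that bounds
        \<sigma>, this is a relative cycle; a chain whose boundary it is modulo \<open>A\<close>
        serves as the new value.\<close>
      let ?z = "frag_of \<sigma> - frag_extend s (chain_boundary (Suc p) (frag_of \<sigma>))"
      have \<sigma>': "singular_chain (Suc p) X (frag_of \<sigma>)" using \<sigma> by (simp add: singular_chain_of)
      have bd: "singular_chain p X (chain_boundary (Suc p) (frag_of \<sigma>))"
        using \<sigma>' by (rule singular_chain_boundary_alt)
      show ?thesis
      proof (cases "singular_simplex (Suc p) ?XA \<sigma>")
        case True
        then have "singular_chain p ?XA (chain_boundary (Suc p) (frag_of \<sigma>))"
          by (intro singular_chain_boundary_alt) (simp add: singular_chain_of)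
        \<comment> \<open>For \<sigma> in \<open>A\<close> the correction term vanishes, so the
          value 0 satisfies the homotopy identity modulo \<open>A\<close>.\<close>
        then have "frag_extend s (chain_boundary (Suc p) (frag_of \<sigma>)) = 0"
          using s by (intro frag_extend_eq_0) (auto simp: P_def singular_chain_def)
        then show ?thesis
          using True by (auto simp: singular_chain_of singular_chain_minus intro!: exI[of _ 0])
      next
        case False
        have "singular_chain (Suc p) X ?z"
          using s bd \<sigma>'
          by (intro singular_chain_diff singular_chain_extend) (auto simp: P_def singular_chain_def)
        moreover have "singular_chain p ?XA (chain_boundary (Suc p) (frag_extend s
            (chain_boundary (Suc p) (frag_of \<sigma>))) - chain_boundary (Suc p) (frag_of \<sigma>))"
          using s bd chain_boundary_boundary_alt[OF \<sigma>'] by (simp add: P_def)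
        then have "singular_chain p ?XA (chain_boundary (Suc p) ?z)"
          unfolding chain_boundary_diff by (subst singular_chain_minus[symmetric]) simp
        ultimately obtain d where "singular_chain (Suc (Suc p)) X d"
          "singular_chain (Suc p) ?XA (chain_boundary (Suc (Suc p)) d - ?z)"
          using pick[of "Suc p" ?z] by auto
        then show ?thesis using False by (auto simp: algebra_simps)
      qed
    qed blast
    then obtain s' where s': "\<And>\<sigma>. singular_simplex (Suc p) X \<sigma> \<Longrightarrow> singular_chain (Suc (Suc p)) X (s' \<sigma>)"
      "\<And>\<sigma>. singular_simplex (Suc p) X \<sigma> \<Longrightarrow>
        singular_chain (Suc p) ?XA (chain_boundary (Suc (Suc p)) (s' \<sigma>) +
           frag_extend s (chain_boundary (Suc p) (frag_of \<sigma>)) - frag_of \<sigma>)"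
      "\<And>\<sigma>. singular_simplex (Suc p) X \<sigma> \<Longrightarrow> singular_simplex (Suc p) ?XA \<sigma> \<Longrightarrow> s' \<sigma> = 0"
      by metis
    have lin: "singular_chain (Suc p) ?XA (chain_boundary (Suc (Suc p)) (frag_extend s' z) +
        frag_extend s (chain_boundary (Suc p) z) - z)" if "singular_chain (Suc p) X z" for z
      using that[unfolded singular_chain_def]
    proof (induction z rule: frag_induction)
      case (diff a b)
      have "chain_boundary (Suc (Suc p)) (frag_extend s' (a - b)) +
            frag_extend s (chain_boundary (Suc p) (a - b)) - (a - b) =
          (chain_boundary (Suc (Suc p)) (frag_extend s' a) + frag_extend s (chain_boundary (Suc p) a) - a) -
          (chain_boundary (Suc (Suc p)) (frag_extend s' b) + frag_extend s (chain_boundary (Suc p) b) - b)"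
        by (simp add: frag_extend_diff chain_boundary_diff algebra_simps)
      then show ?case using diff singular_chain_diff by metis
    qed (use s'(2) in auto)
    have "singular_chain (Suc p) ?XA (chain_boundary (Suc (Suc p)) (frag_extend s' z) - z)"
      if "singular_chain (Suc p) X z" "chain_boundary (Suc p) z = 0" for z
      using lin[OF that(1)] that(2) by simp
    then have "P (Suc p) s' \<and> Q p s s'"
      using s' by (auto simp: P_def Q_def singular_simplex_subtopology)
    then show "\<exists>s'. P (Suc p) s' \<and> Q p s s'" by (rule exI[where x = s'])
  qed
  then obtain s where P: "\<And>p. P p (s p)" and Q: "\<And>p. Q p (s p) (s (Suc p))" by blast
  show ?thesis
  proof
    fix c :: "('a, 'g) coeff_chain"
    assume "c \<in> coeff_relcycles p X A"
    then have c: "coeff_singular_chain p X c" and bd: "coeff_singular_chain (p - 1) ?XA (coeff_boundary p c)"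
      by (auto simp: coeff_relcycles_def)
    have d: "coeff_singular_chain (Suc p) X (coeff_extend (s p) c)"
      using c by (rule coeff_singular_chain_extend) (use P in \<open>auto simp: P_def\<close>)
    have eq: "coeff_boundary (Suc p) (coeff_extend (s p) c) - c =
        coeff_extend (\<lambda>\<sigma>. chain_boundary (Suc p) (s p \<sigma>) - frag_of \<sigma>) c"
      unfolding coeff_boundary_extend coeff_extend_coeff_extend coeff_extend_diff[symmetric]
        coeff_extend_frag_of chain_boundary_frag_extend[symmetric] ..
    have "coeff_singular_chain p ?XA (coeff_extend (\<lambda>\<sigma>. chain_boundary (Suc p) (s p \<sigma>) - frag_of \<sigma>) c)"
    proof (cases p)
      case 0
      \<comment> \<open>\<open>Q\<close> starts in degree 1. In degree 0 every simplex is a cycle,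
        so the identity comes from the last clause of \<open>P 0\<close>.\<close>
      have base: "singular_chain 0 ?XA (chain_boundary (Suc 0) (s 0 \<sigma>) - frag_of \<sigma>)" if "singular_simplex 0 X \<sigma>" for \<sigma>
      proof -
        have "chain_boundary 0 (frag_of \<sigma>) = 0" by (simp add: chain_boundary_of)
        then show ?thesis
          using P[of 0] that unfolding P_def singular_chain_of[symmetric] frag_extend_of[of "s 0" \<sigma>, symmetric]
          by blast
      qed
      show ?thesis
        using c unfolding 0 by (rule coeff_singular_chain_extend) (rule base)
    next
      case (Suc q)
      \<comment> \<open>The boundary of \<open>c\<close> consists of simplices of \<open>A\<close>,
        where \<open>s q\<close> is exactly 0. This removes the second term of the homotopy
        identity.\<close>
      have zero: "coeff_extend (\<lambda>\<sigma>. frag_extend (s q) (chain_boundary p (frag_of \<sigma>))) c = 0"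
      proof -
        have "coeff_extend (s q) (coeff_boundary p c) = 0"
          using bd P[of q] Suc by (intro coeff_extend_eq_0) (auto simp: P_def coeff_singular_chain_def)
        then show ?thesis unfolding coeff_boundary_extend coeff_extend_coeff_extend .
      qed
      have "coeff_singular_chain p ?XA (coeff_extend (\<lambda>\<sigma>. chain_boundary (Suc p) (s p \<sigma>) +
          frag_extend (s q) (chain_boundary p (frag_of \<sigma>)) - frag_of \<sigma>) c)"
        using c by (rule coeff_singular_chain_extend) (use Q[of q] Suc in \<open>auto simp: Q_def\<close>)
      then show ?thesis
        using zero by (simp add: coeff_extend_diff[symmetric] coeff_extend_add[symmetric])
    qed
    then show "c \<in> coeff_relboundaries p X A"
      using d eq unfolding coeff_relboundaries_def by auto
  qed
qed

text \<open>The homotopy keeps \<open>A\<close> inside \<open>A\<close>, so \<open>c\<close> is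
  homologous relative to \<open>A\<close> to its image under \<open>r\<close>, and that image is a
  chain in \<open>A\<close>.\<close>

lemma singular_relboundary_deformation:
  assumes hom: "homotopic_with (\<lambda>h. h \<in> A \<rightarrow> A) X X id r"
    and r: "r ` topspace X \<subseteq> A"
    and c: "singular_relcycle p X A c"
  shows "singular_relboundary p X A c"
proof -
  have chain: "singular_chain p X c" using c by (simp add: singular_relcycle_def)
  have "continuous_map X (subtopology X A) r"
    using homotopic_with_imp_continuous_maps[OF hom] r by (auto simp: continuous_map_in_subtopology)
  then have "singular_chain p (subtopology X A) (chain_map p r c)"
    by (rule singular_chain_chain_map[OF chain])
  then have "singular_relboundary p X A (chain_map p r c)"
    by (rule singular_chain_imp_relboundary)
  moreover have "homologous_rel p X A c (chain_map p r c)"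
    using homotopic_imp_homologous_rel_chain_maps[OF hom c] chain_map_ident[OF chain] by simp
  then have "singular_relboundary p X A (c - chain_map p r c)"
    by (simp add: homologous_rel_def)
  ultimately show ?thesis
    using singular_relboundary_add by fastforce
qed

lemma betti_deformation:
  assumes "homotopic_with (\<lambda>h. h \<in> A \<rightarrow> A) X X id r" "r ` topspace X \<subseteq> A"
  shows "coeff.betti (coeff_chains X :: nat \<Rightarrow> ('a, 'g::ab_group_add) coeff_chain set)
    (coeff_chains (subtopology X A)) p = 0"
proof (rule coeff.betti_eq_0)
  show "coeff.relcycles (coeff_chains X) (coeff_chains (subtopology X A)) p
      \<subseteq> (coeff.relboundaries (coeff_chains X) (coeff_chains (subtopology X A)) p :: ('a, 'g) coeff_chain set)"
    using coeff_relcycles_subset_relboundaries[OF singular_relboundary_deformation[OF assms], of p]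
    by (auto simp: coeff_relcycles_def coeff_relboundaries_def coeff.relcycles_def coeff.relboundaries_def)
qed (auto intro: subcomplex_coeff_chains coeff_singular_chain_mono)

section \<open>The gradient-like flow and the collapsed sublevel sets\<close>

lemma semiflow_continuous_on:
  assumes "semiflow S" "continuous_on X f" "continuous_on X g" "\<And>z. z \<in> X \<Longrightarrow> 0 \<le> f z"
  shows "continuous_on X (\<lambda>z. S (f z) (g z))"
proof -
  have "continuous_on ({0..} \<times> UNIV) (\<lambda>(t, x). S t x)" using assms(1) by (simp add: semiflow_def)
  moreover have "continuous_on X (\<lambda>z. (f z, g z))" using assms(2,3) by (rule continuous_on_Pair)
  moreover have "(\<lambda>z. (f z, g z)) ` X \<subseteq> {0..} \<times> UNIV" using assms(4) by auto
  ultimately have "continuous_on X (\<lambda>z. (\<lambda>(t, x). S t x) (f z, g z))"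
    by (rule continuous_on_compose2)
  then show ?thesis by simp
qed

lemma semiflow_tendsto:
  assumes "semiflow S" "0 \<le> t" "(x \<longlongrightarrow> y) F"
  shows "((\<lambda>n. S t (x n)) \<longlongrightarrow> S t y) F"
proof -
  have "continuous_on UNIV (\<lambda>x. S t x)"
    by (rule semiflow_continuous_on[OF assms(1)]) (use assms(2) in auto)
  then show ?thesis
    using assms(3) continuous_on_tendsto_compose[of UNIV "S t" x y F] by simp
qed

text \<open>Nearest points in \<open>A\<close> have a convergent subsequence, and \<open>y\<close>
  follows it at vanishing distance.\<close>

lemma compact_limit_of_infdist:
  fixes y :: "nat \<Rightarrow> 'a::metric_space"
  assumes "compact A" "A \<noteq> {}" and lim: "(\<lambda>n. infdist (y n) A) \<longlonglongrightarrow> 0"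
  obtains a r where "a \<in> A" "strict_mono r" "(\<lambda>n. y (r n)) \<longlonglongrightarrow> a"
proof -
  have "\<exists>z\<in>A. infdist (y n) A = dist (y n) z" for n
    using continuous_attains_inf[OF assms(1,2), of "dist (y n)"] assms(2)
    by (auto simp: infdist_notempty continuous_intros intro!: antisym cINF_lower cINF_greatest bdd_belowI2[of _ 0])
  then obtain z where z: "\<And>n. z n \<in> A" "\<And>n. infdist (y n) A = dist (y n) (z n)" by metis
  then obtain a r where ar: "a \<in> A" "strict_mono r" "(\<lambda>n. z (r n)) \<longlonglongrightarrow> a"
    using assms(1) unfolding compact_def comp_def by metis
  have "(\<lambda>n. dist (y (r n)) (z (r n))) \<longlonglongrightarrow> 0"
    using LIMSEQ_subseq_LIMSEQ[OF lim ar(2)] by (simp add: z comp_def)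
  moreover have "(\<lambda>n. dist (z (r n)) a) \<longlonglongrightarrow> 0"
    using ar(3) by (rule tendsto_dist_iff[THEN iffD1])
  ultimately have "(\<lambda>n. dist (y (r n)) (z (r n)) + dist (z (r n)) a) \<longlonglongrightarrow> 0"
    using tendsto_add by fastforce
  then have "(\<lambda>n. dist (y (r n)) a) \<longlonglongrightarrow> 0"
    by (rule Lim_null_comparison[rotated]) (simp add: dist_triangle)
  then have "(\<lambda>n. y (r n)) \<longlonglongrightarrow> a" by (rule tendsto_dist_iff[THEN iffD2])
  then show ?thesis using that ar by blast
qed

text \<open>Being attracted by \<open>A\<close> is an open condition in \<A>. If the orbit of the
  limit \<open>a\<close> accumulates on \<open>A\<close>, it enters the interior of an attracted
  neighborhood at a finite time; by continuity so does the orbit of some \<open>x n\<close>, whose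
  limit set then meets \<open>A\<close>.\<close>

lemma closed_dual_repeller:
  assumes S: "semiflow S" and K: "compact \<A>" "invariant S \<A>" and A: "attractor_in S \<A> A"
  shows "closed (dual_repeller S \<A> A)"
  unfolding closed_sequential_limits
proof (intro allI impI, elim conjE)
  fix x a
  assume x: "\<forall>n. x n \<in> dual_repeller S \<A> A" and lim: "x \<longlonglongrightarrow> a"
  then have "a \<in> \<A>"
    using closed_sequentially[OF compact_imp_closed[OF K(1)] _ lim] x by (simp add: dual_repeller_def)
  moreover have "omega_limit S a \<inter> A = {}"
  proof (rule ccontr)
    assume "omega_limit S a \<inter> A \<noteq> {}"
    then obtain y t where y: "y \<in> A" and t: "\<And>n. 0 \<le> t n" "(\<lambda>n. S (t n) a) \<longlonglongrightarrow> y"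
      by (auto simp: omega_limit_def)
    obtain U where U: "neighborhood_in \<A> A U" and att: "attracts S A U"
      using A by (auto simp: attractor_in_def)
    obtain W where W: "open W" "top_of_set \<A> interior_of U = \<A> \<inter> W"
      using openin_interior_of[of "top_of_set \<A>" U] unfolding openin_open by (elim exE conjE) (rule that)
    have sub: "\<A> \<inter> W \<subseteq> U" using interior_of_subset[of "top_of_set \<A>" U] W(2) by simp
    have "A \<subseteq> \<A>" using A by (simp add: attractor_in_def)
    then have "A \<subseteq> \<A> \<inter> W"
      using U closure_of_subset[of A "top_of_set \<A>"] unfolding neighborhood_in_def W(2) by auto
    then have "\<forall>\<^sub>F n in sequentially. S (t n) a \<in> W"
      using y t(2) W(1) topological_tendstoD by blast
    then obtain m where "S (t m) a \<in> W" by (auto simp: eventually_sequentially)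
    then obtain s where s: "0 \<le> s" "S s a \<in> W" using t(1)[of m] by blast
    have "(\<lambda>n. S s (x n)) \<longlonglongrightarrow> S s a" by (rule semiflow_tendsto[OF S s(1) lim])
    then have "\<forall>\<^sub>F n in sequentially. S s (x n) \<in> W"
      using s(2) W(1) topological_tendstoD by blast
    then obtain n where n: "S s (x n) \<in> W" by (auto simp: eventually_sequentially)
    have xA: "x n \<in> \<A>" using x by (simp add: dual_repeller_def)
    have inv: "S t z \<in> \<A>" if "z \<in> \<A>" "0 \<le> t" for t z
      using K(2) that by (auto simp: invariant_def)
    define z where "z = S s (x n)"
    have z: "z \<in> U" using n sub inv[OF xA s(1)] by (auto simp: z_def)
    have "(\<lambda>k. infdist (S (real k) z) A) \<longlonglongrightarrow> 0"
    proof (rule LIMSEQ_I)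
      fix e :: real assume "0 < e"
      then obtain T where T: "\<And>t. t > T \<Longrightarrow> S t ` U \<subseteq> eps_nbhd A e"
        using att \<open>0 < e\<close> unfolding attracts_def by blast
      obtain N :: nat where N: "real N > T" using reals_Archimedean2 by blast
      have "norm (infdist (S (real k) z) A - 0) < e" if "N \<le> k" for k
      proof -
        have "real k > T" using N that by (simp add: order_less_le_trans)
        then show ?thesis using T[of "real k"] z by (auto simp: eps_nbhd_def infdist_nonneg)
      qed
      then show "\<exists>N. \<forall>k\<ge>N. norm (infdist (S (real k) z) A - 0) < e" by blast
    qed
    then obtain w r where w: "w \<in> A" "strict_mono r" "(\<lambda>k. S (real (r k)) z) \<longlonglongrightarrow> w"
      using compact_limit_of_infdist[of A "\<lambda>k. S (real k) z"] A y by (auto simp: attractor_in_def)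
    have "S (real (r k)) z = S (real (r k) + s) (x n)" for k
      using S s(1) by (simp add: semiflow_def z_def)
    then have "(\<lambda>k. S (real (r k) + s) (x n)) \<longlonglongrightarrow> w" using w(3) by simp
    moreover have "filterlim (\<lambda>k. real (r k) + s) at_top sequentially"
      using filterlim_compose[OF filterlim_real_sequentially filterlim_subseq[OF w(2)]]
      by (rule filterlim_at_top_mono) (use s(1) in simp)
    ultimately have "w \<in> omega_limit S (x n)"
      using s(1) unfolding omega_limit_def
      by (intro CollectI exI[of _ "\<lambda>k. real (r k) + s"]) simp
    then show False using x w(1) by (auto simp: dual_repeller_def)
  qed
  ultimately show "a \<in> dual_repeller S \<A> A" by (simp add: dual_repeller_def)
qed

section \<open>Morse sets and the decay of the Lyapunov function\<close>

locale morse_flow =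
  fixes S :: "real \<Rightarrow> 'a::metric_space \<Rightarrow> 'a"
    and \<A> \<Omega> :: "'a set" and l :: nat and M :: "nat \<Rightarrow> 'a set" and V :: "'a \<Rightarrow> real"
  assumes semiflow: "semiflow S"
    and attractor: "attractor S \<A>"
    and basin: "\<Omega> = attraction_basin S \<A>"
    and decomposition: "morse_decomposition S \<A> l M"
    and lyapunov: "strict_morse_lyapunov S \<Omega> l M V"
begin

abbreviation "c k \<equiv> critical_value V (M k)"

abbreviation "proj x \<equiv> morse_rel l M `` {x}"

abbreviation "Q \<equiv> quotient_topology (morse_rel l M)"

abbreviation "sub R \<equiv> {x \<in> \<Omega>. V x \<le> R}"

abbreviation "qsub R \<equiv> quotient_sublevel \<Omega> l M V R"

lemma compact_attractor: "compact \<A>" and invariant_attractor: "invariant S \<A>"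
  using attractor by (auto simp: attractor_in_def)

lemma flow_0 [simp]: "S 0 x = x"
  using semiflow by (simp add: semiflow_def)

lemma flow_add: "0 \<le> t \<Longrightarrow> 0 \<le> s \<Longrightarrow> S (t + s) x = S t (S s x)"
  using semiflow by (simp add: semiflow_def)

lemma compact_morse_set:
  assumes "k \<in> {1..l}"
  shows "compact (M k)"
proof -
  obtain A where A: "\<forall>k\<le>l. attractor_in S \<A> (A k)"
    "\<forall>k\<in>{1..l}. M k = A k \<inter> dual_repeller S \<A> (A (k - 1))"
    using decomposition unfolding morse_decomposition_def by (elim exE conjE) (rule that)
  have "k - 1 \<le> l" "k \<le> l" using assms by auto
  then have "compact (A k)" "closed (dual_repeller S \<A> (A (k - 1)))"
    using A(1) closed_dual_repeller[OF semiflow compact_attractor invariant_attractor]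
    by (auto simp: attractor_in_def)
  then show ?thesis using A(2) assms by (simp add: compact_Int_closed)
qed

lemma morse_set_subset: "k \<in> {1..l} \<Longrightarrow> M k \<subseteq> \<A>"
  using decomposition by (fastforce simp: morse_decomposition_def dual_repeller_def)

lemma attractor_nonempty: "\<A> \<noteq> {}"
proof -
  obtain A where "1 \<le> l" "A 0 = {}" "A l = \<A>" "\<forall>k<l. A k \<subset> A (Suc k)"
    using decomposition by (auto simp: morse_decomposition_def)
  then have "A (l - 1) \<subset> \<A>" by (metis Suc_diff_1 diff_less less_le_trans zero_less_one)
  then show ?thesis by blast
qed

lemma attractor_subset_basin: "\<A> \<subseteq> \<Omega>"
proof
  fix x assume "x \<in> \<A>"
  then have zero: "\<forall>t\<ge>0. infdist (S t x) \<A> = 0"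
    using invariant_attractor by (force simp: invariant_def intro: infdist_zero)
  have "\<forall>\<^sub>F t in at_top. infdist (S t x) \<A> = 0"
    using eventually_ge_at_top[of "0::real"] by eventually_elim (use zero in blast)
  then show "x \<in> \<Omega>"
    using attractor_nonempty by (auto simp: basin attraction_basin_def intro: tendsto_eventually)
qed

lemma basin_flow:
  assumes "x \<in> \<Omega>" "0 \<le> t"
  shows "S t x \<in> \<Omega>"
proof -
  have "((\<lambda>s. infdist (S s x) \<A>) \<longlongrightarrow> 0) at_top"
    using assms(1) by (simp add: basin attraction_basin_def)
  moreover have "filterlim (\<lambda>s::real. s + t) at_top at_top"
    by (rule filterlim_at_top_mono[OF filterlim_ident]) (use assms(2) in auto)
  ultimately have "((\<lambda>s. infdist (S (s + t) x) \<A>) \<longlongrightarrow> 0) at_top"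
    by (rule filterlim_compose)
  moreover have "\<forall>\<^sub>F s in at_top. infdist (S (s + t) x) \<A> = infdist (S s (S t x)) \<A>"
    using eventually_ge_at_top[of "0::real"] by eventually_elim (simp add: flow_add assms(2))
  ultimately have "((\<lambda>s. infdist (S s (S t x)) \<A>) \<longlongrightarrow> 0) at_top"
    by (rule Lim_transform_eventually)
  then show ?thesis using assms(1) by (simp add: basin attraction_basin_def)
qed

lemma V_const: "k \<in> {1..l} \<Longrightarrow> V constant_on M k"
  and V_continuous: "continuous_on \<Omega> V"
  and V_decreasing: "x \<in> \<Omega> - (\<Union>k\<in>{1..l}. M k) \<Longrightarrow> 0 \<le> s \<Longrightarrow> s < t \<Longrightarrow> V (S t x) < V (S s x)"
  using lyapunov by (auto simp: strict_morse_lyapunov_def morse_lyapunov_def monotone_on_def)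

lemma V_critical:
  assumes "k \<in> {1..l}" "x \<in> M k"
  shows "V x = c k"
proof -
  have "V ` M k = {V x}" using V_const[OF assms(1)] assms(2) by (fastforce simp: constant_on_def)
  then show ?thesis by (simp add: critical_value_def)
qed

lemma V_orbit_continuous:
  assumes "continuous_on X f" "continuous_on X g" "\<And>z. z \<in> X \<Longrightarrow> 0 \<le> f z" "\<And>z. z \<in> X \<Longrightarrow> g z \<in> \<Omega>"
  shows "continuous_on X (\<lambda>z. V (S (f z) (g z)))"
  using continuous_on_compose2[OF V_continuous semiflow_continuous_on[OF semiflow assms(1-3)]]
    assms(3,4) basin_flow by blast

text \<open>LaSalle's principle: on the limit set of the orbit the function \<open>V\<close> is constant along the
  flow, so that limit points lie in Morse sets.\<close>

lemma orbit_reaches_critical_value: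
  assumes x: "x \<in> \<Omega> - (\<Union>k\<in>{1..l}. M k)"
  obtains k where "k \<in> {1..l}" "c k < V x" "\<And>v. c k < v \<Longrightarrow> \<exists>t\<ge>0. V (S t x) < v"
proof -
  have mono: "V (S t x) \<le> V (S s x)" if "0 \<le> s" "s \<le> t" for s t
    using V_decreasing[OF x that(1), of t] that(2) by (cases "s = t") auto
  have "((\<lambda>t. infdist (S t x) \<A>) \<longlongrightarrow> 0) at_top"
    using x by (auto simp: basin attraction_basin_def)
  then have "(\<lambda>n. infdist (S (real n) x) \<A>) \<longlonglongrightarrow> 0"
    using filterlim_real_sequentially by (rule filterlim_compose)
  then obtain y r where y: "y \<in> \<A>" "strict_mono r" "(\<lambda>n. S (real (r n)) x) \<longlonglongrightarrow> y"
    by (rule compact_limit_of_infdist[OF compact_attractor attractor_nonempty])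
  have lim: "(\<lambda>n. V (S (s + real (r n)) x)) \<longlonglongrightarrow> V (S s y)" if "0 \<le> s" for s
  proof -
    have "(\<lambda>n. S (s + real (r n)) x) \<longlonglongrightarrow> S s y"
      using semiflow_tendsto[OF semiflow that y(3)] that by (simp add: flow_add)
    then show ?thesis
      by (rule continuous_on_tendsto_compose[OF V_continuous])
         (use that y(1) x basin_flow attractor_subset_basin in auto)
  qed
  have lim_0: "(\<lambda>n. V (S (real (r n)) x)) \<longlonglongrightarrow> V y" using lim[of 0] by simp
  have le: "V y \<le> V (S t x)" if "0 \<le> t" for t
  proof (rule LIMSEQ_le_const2)
    show "(\<lambda>n. V (S (real (r n)) x)) \<longlonglongrightarrow> V y" by (rule lim_0)
    obtain N :: nat where "t \<le> real N" using real_arch_simple by blast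
    then have "t \<le> real (r n)" if "N \<le> n" for n
      using seq_suble[OF y(2), of n] that by linarith
    then show "\<exists>N. \<forall>n\<ge>N. V (S (real (r n)) x) \<le> V (S t x)"
      using mono[OF \<open>0 \<le> t\<close>] by blast
  qed
  have "V (S s y) = V y" if "0 \<le> s" for s
  proof (rule antisym)
    show "V (S s y) \<le> V y"
      by (rule LIMSEQ_le[OF lim[OF that] lim_0]) (use mono that in auto)
    show "V y \<le> V (S s y)"
      by (rule LIMSEQ_le_const[OF lim[OF that]]) (use le that in auto)
  qed
  then have "y \<notin> \<Omega> - (\<Union>k\<in>{1..l}. M k)"
    using V_decreasing[of y 0 1] by auto
  then obtain k where k: "k \<in> {1..l}" "y \<in> M k"
    using y(1) attractor_subset_basin by blast
  have ck: "c k = V y" using V_critical[OF k] by simp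
  show ?thesis
  proof
    show "k \<in> {1..l}" by fact
    \<comment> \<open>One unit of time makes the inequality strict: V y is at most V (S 1 x), which
      is already below V x.\<close>
    show "c k < V x" using le[of 1] V_decreasing[OF x, of 0 1] ck by simp
    fix v assume "c k < v"
    then have "\<forall>\<^sub>F n in sequentially. V (S (real (r n)) x) < v"
      using lim_0 ck by (intro order_tendstoD(2)) auto
    then obtain n where "V (S (real (r n)) x) < v" by (auto simp: eventually_sequentially)
    then show "\<exists>t\<ge>0. V (S t x) < v" by (intro exI[of _ "real (r n)"]) simp
  qed
qed

section \<open>The collapsing map\<close>

lemma proj_eq_iff: "proj x = proj y \<longleftrightarrow> x = y \<or> (\<exists>k\<in>{1..l}. x \<in> M k \<and> y \<in> M k)"
  using eq_equiv_class_iff[OF equiv_morse_rel[OF lyapunov], of x y] by (simp add: morse_rel_def)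

lemma quotient_fun_proj: "quotient_fun V (proj x) = V x"
  by (rule quotient_fun_class[OF V_const])

text \<open>Sublevel sets are saturated, because \<open>V\<close> is constant on Morse sets and
  these lie in \<Omega>.\<close>

lemma proj_in_qsub_iff: "proj x \<in> qsub R \<longleftrightarrow> x \<in> \<Omega> \<and> V x \<le> R"
proof
  assume "proj x \<in> qsub R"
  then obtain y where y: "y \<in> \<Omega>" "proj x = proj y" and "quotient_fun V (proj x) \<le> R"
    by (auto simp: quotient_sublevel_def quotient_def)
  moreover have "x \<in> \<Omega>"
    using y morse_set_subset attractor_subset_basin by (fastforce simp: proj_eq_iff)
  ultimately show "x \<in> \<Omega> \<and> V x \<le> R" using quotient_fun_proj[of x] by simp
qed (auto simp: quotient_sublevel_def quotient_fun_proj intro: quotientI)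

lemma qsub_eq: "qsub R = proj ` sub R"
proof
  show "qsub R \<subseteq> proj ` sub R"
  proof
    fix C assume C: "C \<in> qsub R"
    then obtain y where "C = proj y" by (auto simp: quotient_sublevel_def quotient_def)
    then show "C \<in> proj ` sub R" using C proj_in_qsub_iff by auto
  qed
qed (use proj_in_qsub_iff in auto)

text \<open>Saturating a closed set adds only finitely many compact Morse sets, and each fibre is a
  point or a Morse set.\<close>

lemma proper_map_proj: "proper_map euclidean Q proj"
  unfolding proper_map_def
proof (intro conjI ballI)
  show "closed_map euclidean Q proj"
    unfolding closed_map_def
  proof (intro allI impI)
    fix C :: "'a set" assume "closedin euclidean C"
    then have "closed C" by simp
    have "{x. proj x \<in> proj ` C} = C \<union> (\<Union>k\<in>{k \<in> {1..l}. M k \<inter> C \<noteq> {}}. M k)"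
      by (auto simp: image_iff proj_eq_iff)
    moreover have "closed \<dots>"
      using \<open>closed C\<close> compact_morse_set by (intro closed_Un closed_UN) (auto intro: compact_imp_closed)
    ultimately have "open (- {x. proj x \<in> proj ` C})" by (simp add: closed_def)
    moreover have "{x. proj x \<in> UNIV // morse_rel l M - proj ` C} = - {x. proj x \<in> proj ` C}"
      by (auto intro: quotientI)
    ultimately show "closedin Q (proj ` C)"
      by (auto simp: closedin_def topspace_quotient_topology openin_quotient_topology intro: quotientI)
  qed
  fix y assume "y \<in> topspace Q"
  then obtain x where y: "y = proj x" by (auto simp: topspace_quotient_topology quotient_def)
  have "{z. proj z = proj x} = insert x (\<Union>k\<in>{k \<in> {1..l}. x \<in> M k}. M k)"
    by (auto simp: proj_eq_iff)
  moreover have "compact \<dots>"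
    using compact_morse_set by (intro compact_insert compact_UN) auto
  ultimately show "compactin euclidean {x \<in> topspace euclidean. proj x = y}"
    by (simp add: y)
qed

text \<open>Needed to push a homotopy down along the collapse. Properness passes to the restriction
  and to the product with [0,1]; a proper map is closed, and a continuous closed surjection is a
  quotient map.\<close>

lemma quotient_map_prod_qsub:
  "quotient_map (prod_topology (top_of_set {0..1::real}) (top_of_set (sub b)))
     (prod_topology (top_of_set {0..1}) (subtopology Q (qsub b))) (\<lambda>(t, x). (t, proj x))"
proof (rule continuous_closed_imp_quotient_map)
  have "continuous_map (top_of_set (sub b)) (subtopology Q (qsub b)) proj"
    using quotient_imp_continuous_map[OF quotient_map_quotient_topology[of "morse_rel l M"]]
    by (auto simp: continuous_map_in_subtopology proj_in_qsub_iff continuous_map_from_subtopology)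
  then have "continuous_map (prod_topology (top_of_set {0..1::real}) (top_of_set (sub b)))
     (subtopology Q (qsub b)) (proj \<circ> snd)"
    using continuous_map_snd continuous_map_compose by blast
  then show "continuous_map (prod_topology (top_of_set {0..1::real}) (top_of_set (sub b)))
     (prod_topology (top_of_set {0..1}) (subtopology Q (qsub b))) (\<lambda>(t, x). (t, proj x))"
    unfolding continuous_map_pairwise case_prod_unfold comp_def fst_conv snd_conv
    by (intro conjI continuous_map_fst)
  have "proper_map (top_of_set (sub b)) (subtopology Q (qsub b)) proj"
    by (rule proper_map_restriction[OF proper_map_proj]) (auto simp: proj_in_qsub_iff)
  then have "proper_map (prod_topology (top_of_set {0..1::real}) (top_of_set (sub b)))
     (prod_topology (top_of_set {0..1}) (subtopology Q (qsub b))) (\<lambda>(t, x). (t, proj x))"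
    using proper_map_prod[where f = "\<lambda>t. t" and g = proj] proper_map_id[unfolded id_def] by blast
  then show "closed_map (prod_topology (top_of_set {0..1::real}) (top_of_set (sub b)))
     (prod_topology (top_of_set {0..1}) (subtopology Q (qsub b))) (\<lambda>(t, x). (t, proj x))"
    by (rule proper_imp_closed_map)
  have "qsub b \<subseteq> topspace Q"
    by (auto simp: topspace_quotient_topology quotient_sublevel_def quotient_def)
  then show "(\<lambda>(t, x). (t, proj x)) ` topspace (prod_topology (top_of_set {0..1::real}) (top_of_set (sub b)))
      = topspace (prod_topology (top_of_set {0..1}) (subtopology Q (qsub b)))"
    by (auto simp: qsub_eq)
qed

text \<open>\<open>T\<close> is the first time at which \<open>V\<close> is at most
  \<open>a\<close>. It is finite because the orbit comes arbitrarily close to a critical value below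
  \<open>a\<close>, and continuous because \<open>V\<close> crosses the level \<open>a\<close>
  strictly.\<close>

lemma hitting_time:
  assumes ab: "a \<le> b" and regular: "\<And>k. k \<in> {1..l} \<Longrightarrow> c k \<notin> {a..b}"
  shows "\<exists>T. continuous_on (sub b) T \<and> (\<forall>x\<in>sub a. T x = 0) \<and>
    (\<forall>x\<in>sub b. 0 \<le> T x \<and> V (S (T x) x) \<le> a \<and> (\<forall>t\<in>{0..T x}. V (S t x) \<le> b))"
proof -
  \<comment> \<open>The level \<open>a\<close> itself is included; this is what makes orbits
    strictly decrease through it.\<close>
  have noncrit: "x \<in> \<Omega> - (\<Union>k\<in>{1..l}. M k)" if "x \<in> sub b" "a \<le> V x" for x
    using that regular V_critical by fastforce
  have "\<exists>t\<ge>0. (V x \<le> a \<longrightarrow> t = 0) \<and> (a < V x \<longrightarrow> V (S t x) = a)" if x: "x \<in> sub b" for x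
  proof (cases "V x \<le> a")
    case False
    then obtain k where k: "k \<in> {1..l}" "c k < V x" "\<And>v. c k < v \<Longrightarrow> \<exists>t\<ge>0. V (S t x) < v"
      using orbit_reaches_critical_value[OF noncrit[OF x]] by (metis linear)
    then have "c k < a" using regular[OF k(1)] x by auto
    then obtain t where t: "0 \<le> t" "V (S t x) < a" using k(3) by blast
    have "continuous_on {0..t} (\<lambda>t. V (S t x))"
      by (rule V_orbit_continuous) (use x in \<open>auto intro: continuous_intros\<close>)
    then obtain s where "0 \<le> s" "V (S s x) = a"
      using IVT2'[of "\<lambda>t. V (S t x)" t a 0] t False by auto
    then show ?thesis using False by auto
  qed auto
  then have "\<exists>T. \<forall>x\<in>sub b. 0 \<le> T x \<and> (V x \<le> a \<longrightarrow> T x = 0) \<and> (a < V x \<longrightarrow> V (S (T x) x) = a)"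
    by (intro bchoice) blast
  then obtain T where T: "\<And>x. x \<in> sub b \<Longrightarrow> 0 \<le> T x" "\<And>x. x \<in> sub b \<Longrightarrow> V x \<le> a \<Longrightarrow> T x = 0"
    "\<And>x. x \<in> sub b \<Longrightarrow> a < V x \<Longrightarrow> V (S (T x) x) = a"
    by blast
  \<comment> \<open>\<open>above\<close> and \<open>below\<close> rewrite the sets where
    \<open>T\<close> exceeds or stays under \<open>s\<close> by strict inequalities for
    \<open>V\<close> at fixed times. These are open conditions, so \<open>T\<close> is lower and
    upper semicontinuous.\<close>
  have above: "s < T x \<longleftrightarrow> a < V x \<and> a < V (S s x)" if "x \<in> sub b" "0 \<le> s" for x s
  proof (cases "a < V x")
    case True
    then have nc: "x \<in> \<Omega> - (\<Union>k\<in>{1..l}. M k)" using noncrit that(1) by force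
    have "a < V (S s x)" if "s < T x"
      using V_decreasing[OF nc \<open>0 \<le> s\<close> that] T(3) True \<open>x \<in> sub b\<close> by simp
    moreover have "V (S s x) \<le> a" if "T x \<le> s"
      using V_decreasing[OF nc T(1)[OF \<open>x \<in> sub b\<close>], of s] T(3)[OF \<open>x \<in> sub b\<close> True] that
      by (cases "s = T x") auto
    ultimately show ?thesis using True by fastforce
  qed (use T(2)[of x] that in auto)
  have below: "T x < s \<longleftrightarrow> (\<exists>t\<in>{0..<s}. V (S t x) < a)" if x: "x \<in> sub b" and s: "0 < s" for x s
  proof
    assume less: "T x < s"
    show "\<exists>t\<in>{0..<s}. V (S t x) < a"
    proof (cases "V x < a")
      case True
      then show ?thesis using s by (intro bexI[of _ 0]) auto
    next
      case False
      then have nc: "x \<in> \<Omega> - (\<Union>k\<in>{1..l}. M k)" using noncrit[OF x] by simp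
      have "V (S (T x) x) \<le> a" using T(2,3)[OF x] by (cases "V x \<le> a") auto
      \<comment> \<open>At the hitting time \<open>V\<close> may equal \<open>a\<close>; the
        midpoint between \<open>T x\<close> and \<open>s\<close> is a later time, still before
        \<open>s\<close>, with value strictly below \<open>a\<close>.\<close>
      moreover have "V (S ((T x + s) / 2) x) < V (S (T x) x)"
        using V_decreasing[OF nc T(1)[OF x]] less by simp
      ultimately show ?thesis using T(1)[OF x] less by (intro bexI[of _ "(T x + s) / 2"]) auto
    qed
  next
    assume "\<exists>t\<in>{0..<s}. V (S t x) < a"
    then obtain t where t: "0 \<le> t" "t < s" "V (S t x) < a" by auto
    then have "\<not> t < T x" using above[OF x t(1)] by simp
    then show "T x < s" using t(2) by simp
  qed
  have level: "continuous_on (sub b) (\<lambda>x. V (S t x))" if "0 \<le> t" for t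
    by (rule V_orbit_continuous) (use that in \<open>auto intro: continuous_intros\<close>)
  have op_less: "openin (top_of_set (sub b)) {x \<in> sub b. V (S t x) < v}"
    and op_greater: "openin (top_of_set (sub b)) {x \<in> sub b. v < V (S t x)}" if "0 \<le> t" for t v
    using level[OF that, folded continuous_map_iff_continuous]
    unfolding continuous_map_upper_lower_semicontinuous_lt by auto
  have "continuous_map (top_of_set (sub b)) euclidean T"
    unfolding continuous_map_upper_lower_semicontinuous_lt
  proof (intro conjI allI)
    fix s
    show "openin (top_of_set (sub b)) {x \<in> topspace (top_of_set (sub b)). s < T x}"
    proof (cases "0 \<le> s")
      case True
      then have "{x \<in> sub b. s < T x} = {x \<in> sub b. a < V x} \<inter> {x \<in> sub b. a < V (S s x)}"
        using above by auto
      moreover have "openin (top_of_set (sub b)) \<dots>"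
        using op_greater[of 0 a] op_greater[OF True, of a] by (intro openin_Int) simp_all
      ultimately show ?thesis by simp
    next
      case False
      then have "{x \<in> sub b. s < T x} = sub b" using T(1) by force
      then show ?thesis by simp
    qed
    show "openin (top_of_set (sub b)) {x \<in> topspace (top_of_set (sub b)). T x < s}"
    proof (cases "0 < s")
      case True
      then have "{x \<in> sub b. T x < s} = (\<Union>t\<in>{0..<s}. {x \<in> sub b. V (S t x) < a})"
        using below by auto
      moreover have "openin (top_of_set (sub b)) \<dots>" using op_less by (intro openin_Union) auto
      ultimately show ?thesis by simp
    next
      case False
      then have empty: "{x \<in> topspace (top_of_set (sub b)). T x < s} = {}" using T(1) by force
      show ?thesis unfolding empty by simp
    qed
  qed
  then have cont: "continuous_on (sub b) T" by simp
  show ?thesis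
  proof (intro exI conjI ballI)
    show "continuous_on (sub b) T" by fact
    show "0 \<le> T x" if "x \<in> sub b" for x using T(1) that .
    show "T x = 0" if "x \<in> sub a" for x using T(2)[of x] that ab by simp
    show "V (S (T x) x) \<le> a" if "x \<in> sub b" for x
      using T(2,3)[OF that] by (cases "V x \<le> a") auto
    show "V (S t x) \<le> b" if "x \<in> sub b" "t \<in> {0..T x}" for x t
    proof (cases "V x \<le> a \<or> t = 0")
      case True
      then show ?thesis using T(2)[of x] that by auto
    next
      case False
      then have "V (S t x) < V x"
        using V_decreasing[OF noncrit, of x 0 t] that by simp
      then show ?thesis using that(1) by simp
    qed
  qed
qed

text \<open>The flow stopped at the hitting time, run at proportional speed so that all points
  arrive at time 1. It is stationary on V_a, hence keeps it invariant.\<close>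

lemma deformation_qsub:
  assumes ab: "a \<le> b" and regular: "\<And>k. k \<in> {1..l} \<Longrightarrow> c k \<notin> {a..b}"
  obtains r where
    "homotopic_with (\<lambda>h. h \<in> qsub a \<rightarrow> qsub a) (subtopology Q (qsub b)) (subtopology Q (qsub b)) id r"
    "r ` topspace (subtopology Q (qsub b)) \<subseteq> qsub a"
proof -
  let ?I = "top_of_set {0..1::real}"
  obtain T where T: "continuous_on (sub b) T" "\<And>x. x \<in> sub b \<Longrightarrow> 0 \<le> T x"
    "\<And>x. x \<in> sub a \<Longrightarrow> T x = 0" "\<And>x. x \<in> sub b \<Longrightarrow> V (S (T x) x) \<le> a"
    "\<And>x t. x \<in> sub b \<Longrightarrow> 0 \<le> t \<Longrightarrow> t \<le> T x \<Longrightarrow> V (S t x) \<le> b"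
    using hitting_time[OF assms] by auto
  define H where "H = (\<lambda>(t, x). S (t * T x) x)"
  have H_sub: "H (t, x) \<in> sub b" if "t \<in> {0..1}" "x \<in> sub b" for t x
    using T(2)[OF that(2)] T(5)[OF that(2), of "t * T x"] that basin_flow
    by (auto simp: H_def mult_left_le_one_le)
  have "continuous_on ({0..1} \<times> sub b) H"
    unfolding H_def case_prod_unfold
    by (rule semiflow_continuous_on[OF semiflow])
       (auto intro!: continuous_intros continuous_on_compose2[OF T(1)] mult_nonneg_nonneg T(2))
  then have "continuous_map (top_of_set ({0..1} \<times> sub b)) (top_of_set (sub b)) H"
    using H_sub by (auto simp: continuous_map_in_subtopology)
  then have H_cont: "continuous_map (prod_topology ?I (top_of_set (sub b))) (top_of_set (sub b)) H"
    by (simp add: prod_topology_subtopology(2)[symmetric] subtopology_Times[symmetric]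
        flip: euclidean_product_topology)
  have "continuous_map (top_of_set (sub b)) (subtopology Q (qsub b)) proj"
    using quotient_imp_continuous_map[OF quotient_map_quotient_topology[of "morse_rel l M"]]
    by (auto simp: continuous_map_in_subtopology proj_in_qsub_iff continuous_map_from_subtopology)
  then have cont: "continuous_map (prod_topology ?I (top_of_set (sub b))) (subtopology Q (qsub b)) (proj \<circ> H)"
    using continuous_map_compose[OF H_cont] by blast
  \<comment> \<open>Distinct points of one fibre share a Morse set. Its value is at most
    \<open>b\<close> and not in [a,b], so it lies in V_a, where nothing moves.\<close>
  have compat: "proj (H (t, x)) = proj (H (t, y))" if xy: "x \<in> sub b" "y \<in> sub b" "proj x = proj y" for t x y
  proof (cases "x = y")
    case False
    then obtain k where k: "k \<in> {1..l}" "x \<in> M k" "y \<in> M k" using xy(3) by (auto simp: proj_eq_iff)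
    then have "x \<in> sub a" "y \<in> sub a"
      using xy regular[OF k(1)] V_critical[OF k(1)] by auto
    then show ?thesis using T(3) xy(3) by (simp add: H_def)
  qed simp
  have "(proj \<circ> H) z = (proj \<circ> H) z'"
    if "z \<in> topspace (prod_topology ?I (top_of_set (sub b)))"
      "z' \<in> topspace (prod_topology ?I (top_of_set (sub b)))"
      "(\<lambda>(t, x). (t, proj x)) z = (\<lambda>(t, x). (t, proj x)) z'" for z z'
    using that compat[of "snd z" "snd z'" "fst z"] by (cases z; cases z') auto
  note lift = quotient_map_lift_exists[OF quotient_map_prod_qsub[of b] cont this]
  obtain h where h: "continuous_map (prod_topology ?I (subtopology Q (qsub b))) (subtopology Q (qsub b)) h"
    and h_proj: "\<And>z. z \<in> topspace (prod_topology ?I (top_of_set (sub b))) \<Longrightarrow>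
      h ((\<lambda>(t, x). (t, proj x)) z) = (proj \<circ> H) z"
    by (rule lift) (assumption | blast)+
  have h_eq: "h (t, proj x) = proj (H (t, x))" if "t \<in> {0..1}" "x \<in> sub b" for t x
    using h_proj[of "(t, x)"] that by simp
  have top: "topspace (subtopology Q (qsub b)) = proj ` sub b"
    by (auto simp: qsub_eq topspace_quotient_topology intro: quotientI)
  have sub_ab: "sub a \<subseteq> sub b" using ab by auto
  show ?thesis
  proof
    show "homotopic_with (\<lambda>h. h \<in> qsub a \<rightarrow> qsub a) (subtopology Q (qsub b)) (subtopology Q (qsub b)) id (\<lambda>y. h (1, y))"
    proof (subst homotopic_with)
      show "(f \<in> qsub a \<rightarrow> qsub a) = (g \<in> qsub a \<rightarrow> qsub a)"
        if "\<And>y. y \<in> topspace (subtopology Q (qsub b)) \<Longrightarrow> f y = g y" for f g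
      proof -
        have "f y = g y" if "y \<in> qsub a" for y
          using that \<open>\<And>y. y \<in> topspace _ \<Longrightarrow> f y = g y\<close> sub_ab unfolding top by (auto simp: qsub_eq)
        then show ?thesis by (auto simp: Pi_iff)
      qed
      have "h (t, y) \<in> qsub a" if ty: "t \<in> {0..1}" "y \<in> qsub a" for t y
      proof -
        obtain x where x: "y = proj x" "x \<in> sub a" using ty(2) by (auto simp: qsub_eq)
        then have "h (t, y) = proj x" using h_eq[OF ty(1), of x] sub_ab T(3)[of x] by (auto simp: H_def)
        then show ?thesis using ty(2) x by simp
      qed
      moreover have "h (0, y) = y" if y: "y \<in> topspace (subtopology Q (qsub b))" for y
      proof -
        obtain x where "y = proj x" "x \<in> sub b" using y unfolding top by blast
        then show ?thesis using h_eq[of 0 x] by (simp add: H_def)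
      qed
      ultimately show "\<exists>h'. continuous_map (prod_topology ?I (subtopology Q (qsub b))) (subtopology Q (qsub b)) h' \<and>
          (\<forall>x\<in>topspace (subtopology Q (qsub b)). h' (0, x) = id x) \<and>
          (\<forall>x\<in>topspace (subtopology Q (qsub b)). h' (1, x) = h (1, x)) \<and>
          (\<forall>t\<in>{0..1}. (\<lambda>x. h' (t, x)) \<in> qsub a \<rightarrow> qsub a)"
        using h by (intro exI[of _ h]) (simp add: Pi_iff)
    qed
    show "(\<lambda>y. h (1, y)) ` topspace (subtopology Q (qsub b)) \<subseteq> qsub a"
    proof -
      have "h (1, proj x) \<in> qsub a" if "x \<in> sub b" for x
        using h_eq[of 1 x] that T(2,4)[OF that] basin_flow[of x "T x"] by (simp add: H_def proj_in_qsub_iff)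
      then show ?thesis unfolding top by auto
    qed
  qed
qed

text \<open>Every point of \<Omega> lies at or above some critical value: a Morse point on its own,
  any other point above the value its orbit descends to.\<close>

lemma qsub_empty:
  assumes "\<And>k. k \<in> {1..l} \<Longrightarrow> R < c k"
  shows "qsub R = {}"
proof -
  have False if "x \<in> sub R" for x
  proof (cases "x \<in> (\<Union>k\<in>{1..l}. M k)")
    case True
    then show False using assms V_critical that by fastforce
  next
    case False
    then have "x \<in> \<Omega> - (\<Union>k\<in>{1..l}. M k)" using that by blast
    then obtain k where "k \<in> {1..l}" "c k < V x"
      by (rule orbit_reaches_critical_value)
    then show False using assms[of k] that by simp
  qed
  then show ?thesis by (auto simp: qsub_eq)
qed

end

section \<open>Morse inequalities\<close>

text \<open>\<open>h k\<close> holds the Betti numbers of stage \<open>k\<close>,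
  \<open>m (Suc k)\<close> those of the next successive pair, and \<open>r\<close> the connecting
  ranks. Finiteness is inherited: with \<open>h k\<close> and \<open>m\<close> finite,
  \<open>r\<close> and \<open>h (Suc k)\<close> are finite too. The function \<open>D\<close>
  accumulates the ranks \<open>r\<close>.\<close>

lemma filtration_betti_numbers:
  fixes h :: "nat \<Rightarrow> nat \<Rightarrow> enat" and m :: "nat \<Rightarrow> nat \<Rightarrow> nat"
  assumes h_0: "\<And>q. h 0 q = 0"
    and step: "\<And>k. k < l \<Longrightarrow> \<exists>r. \<forall>q. r q \<le> h k q \<and>
      h k q + enat (m (Suc k) q) = h (Suc k) q + r q + (if q = 0 then 0 else r (q - 1))"
  shows "\<exists>\<beta> D. \<forall>q. h l q = enat (\<beta> q) \<and>
    (\<Sum>k=1..l. m k q) = \<beta> q + D q + (if q = 0 then 0 else D (q - 1))"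
  using step
proof (induction l)
  case 0
  then show ?case
    by (intro exI[of _ "\<lambda>_. 0"]) (simp add: h_0 zero_enat_def)
next
  case (Suc l)
  obtain \<beta> D where \<beta>: "\<And>q. h l q = enat (\<beta> q)"
    and D: "\<And>q. (\<Sum>k=1..l. m k q) = \<beta> q + D q + (if q = 0 then 0 else D (q - 1))"
    using Suc.IH Suc.prems by (metis less_Suc_eq)
  obtain r where r: "\<And>q. r q \<le> h l q"
    "\<And>q. h l q + enat (m (Suc l) q) = h (Suc l) q + r q + (if q = 0 then 0 else r (q - 1))"
    using Suc.prems[of l] by auto
  have "\<exists>n. r q = enat n" for q using r(1)[of q] \<beta>[of q] by (cases "r q") auto
  then obtain \<rho> where \<rho>: "\<And>q. r q = enat (\<rho> q)" by metis
  have "h (Suc l) q \<noteq> \<infinity>" for q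
    using r(2)[of q] \<beta>[of q] by (metis enat.distinct(1) plus_enat_simps(1,2))
  then have "\<exists>n. h (Suc l) q = enat n" for q by (meson not_infinity_eq)
  then obtain \<beta>' where \<beta>': "\<And>q. h (Suc l) q = enat (\<beta>' q)" by metis
  have eq: "\<beta> q + m (Suc l) q = \<beta>' q + \<rho> q + (if q = 0 then 0 else \<rho> (q - 1))" for q
    using r(2)[of q] by (cases "q = 0") (simp_all add: \<beta> \<beta>' \<rho> zero_enat_def)
  show ?case
  proof (intro exI allI conjI)
    fix q
    show "h (Suc l) q = enat (\<beta>' q)" by (rule \<beta>')
    show "(\<Sum>k=1..Suc l. m k q) =
        \<beta>' q + (D q + \<rho> q) + (if q = 0 then 0 else D (q - 1) + \<rho> (q - 1))"
      using D[of q] eq[of q] by (cases "q = 0") simp_all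
  qed
qed

text \<open>Each \<open>D i\<close> occurs in degrees \<open>i\<close> and \<open>i + 1\<close> with
  opposite signs; only the top one survives.\<close>

lemma alternating_sum_eq:
  fixes m \<beta> D :: "nat \<Rightarrow> nat"
  assumes "\<And>q. m q = \<beta> q + D q + (if q = 0 then 0 else D (q - 1))"
  shows "(\<Sum>i\<le>q. (-1) ^ (q - i) * int (m i)) = (\<Sum>i\<le>q. (-1) ^ (q - i) * int (\<beta> i)) + int (D q)"
proof (induction q)
  case 0
  then show ?case using assms[of 0] by simp
next
  case (Suc q)
  have alt: "(\<Sum>i\<le>Suc q. (-1) ^ (Suc q - i) * int (x i)) =
      int (x (Suc q)) - (\<Sum>i\<le>q. (-1) ^ (q - i) * int (x i))" for x
    by (simp add: Suc_diff_le sum_negf)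
  show ?case unfolding alt Suc using assms[of "Suc q"] by simp
qed

text \<open>The terms are integers tending to 0, hence eventually 0. Then \<open>\<beta>\<close> and
  \<open>D\<close> vanish from the same index on, and with them the remainder of the telescoped
  partial sum.\<close>

lemma alternating_series_eq:
  fixes m \<beta> D :: "nat \<Rightarrow> nat"
  assumes eq: "\<And>q. m q = \<beta> q + D q + (if q = 0 then 0 else D (q - 1))"
    and summable: "summable (\<lambda>q. (-1) ^ q * real (m q))"
  shows "summable (\<lambda>q. (-1) ^ q * real (\<beta> q))"
    "suminf (\<lambda>q. (-1) ^ q * real (m q)) = suminf (\<lambda>q. (-1) ^ q * real (\<beta> q))"
proof -
  have "(\<lambda>q. (-1) ^ q * real (m q)) \<longlonglongrightarrow> 0" by (rule summable_LIMSEQ_zero[OF summable])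
  then obtain N where N: "\<And>q. N \<le> q \<Longrightarrow> norm ((-1) ^ q * real (m q) - 0) < 1"
    using LIMSEQ_D[of _ 0 1] by fastforce
  have m0: "m q = 0" if "N \<le> q" for q using N[OF that] by (simp add: abs_mult)
  have \<beta>0: "\<beta> q = 0" and D0: "D q = 0" if "N \<le> q" for q
    using eq[of q] m0[OF that] by simp_all
  have partial: "(\<Sum>q<Suc n. (-1) ^ q * real (m q)) =
      (\<Sum>q<Suc n. (-1) ^ q * real (\<beta> q)) + (-1) ^ n * real (D n)" for n
  proof (induction n)
    case 0
    then show ?case using eq[of 0] by simp
  next
    case (Suc n)
    then show ?case unfolding sum.lessThan_Suc[of _ "Suc n"] Suc using eq[of "Suc n"]
      by (simp add: algebra_simps)
  qed
  have \<beta>_sums: "(\<lambda>q. (-1) ^ q * real (\<beta> q)) sums (\<Sum>q<Suc N. (-1) ^ q * real (\<beta> q))"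
    by (rule sums_finite) (auto simp: \<beta>0)
  have "(\<lambda>q. (-1) ^ q * real (m q)) sums (\<Sum>q<Suc N. (-1) ^ q * real (m q))"
    by (rule sums_finite) (auto simp: m0)
  then show "suminf (\<lambda>q. (-1) ^ q * real (m q)) = suminf (\<lambda>q. (-1) ^ q * real (\<beta> q))"
    using \<beta>_sums partial[of N] D0[of N] by (simp add: sums_iff)
  show "summable (\<lambda>q. (-1) ^ q * real (\<beta> q))" using \<beta>_sums by (rule sums_summable)
qed

context morse_flow
begin

section \<open>Betti numbers of pairs of collapsed sublevel sets\<close>

definition qchains :: "real \<Rightarrow> nat \<Rightarrow> ('a set, 'g::ab_group_add) coeff_chain set" where
  "qchains R = coeff_chains (subtopology Q (qsub R))"

lemma subcomplex_qchains: "coeff.subcomplex (qchains R)"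
  unfolding qchains_def by (rule subcomplex_coeff_chains)

lemma qsub_mono: "a \<le> b \<Longrightarrow> qsub a \<subseteq> qsub b"
  by (auto simp: quotient_sublevel_def)

lemma subtopology_qsub: "a \<le> b \<Longrightarrow> subtopology (subtopology Q (qsub b)) (qsub a) = subtopology Q (qsub a)"
  using qsub_mono[of a b] by (simp add: subtopology_subtopology Int_absorb1)

lemma qchains_mono:
  "a \<le> b \<Longrightarrow> qchains a p \<subseteq> (qchains b p :: ('a set, 'g::ab_group_add) coeff_chain set)"
  using subtopology_qsub[of a b] coeff_singular_chain_mono[of p "subtopology Q (qsub b)" "qsub a"]
  by (auto simp: qchains_def)

lemma group_rank_qsub:
  assumes "a \<le> b"
  shows "group_rank (coeff_relative_homology_group q (subtopology Q (qsub b)) (qsub a)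
      :: ('a set, 'g::ab_group_add) coeff_chain set monoid) =
    coeff.betti (qchains b :: nat \<Rightarrow> ('a set, 'g) coeff_chain set) (qchains a) q"
  unfolding group_rank_coeff_relative_homology_group qchains_def subtopology_qsub[OF assms] ..

lemma betti_regular:
  assumes "a \<le> b" "\<And>k. k \<in> {1..l} \<Longrightarrow> c k \<notin> {a..b}"
  shows "coeff.betti (qchains b :: nat \<Rightarrow> ('a set, 'g::ab_group_add) coeff_chain set) (qchains a) q = 0"
proof -
  obtain r where
    "homotopic_with (\<lambda>h. h \<in> qsub a \<rightarrow> qsub a) (subtopology Q (qsub b)) (subtopology Q (qsub b)) id r"
    "r ` topspace (subtopology Q (qsub b)) \<subseteq> qsub a"
    using deformation_qsub[OF assms] .
  then show ?thesis
    using betti_deformation[of "qsub a" "subtopology Q (qsub b)" r q, where 'g = 'g]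
    by (simp add: qchains_def subtopology_qsub[OF assms(1)])
qed

text \<open>Lowering \<open>b\<close> to \<beta> and raising \<open>a\<close> to \<alpha> crosses no
  critical value, so the pairs in between are acyclic and cancel in the two triples.\<close>

lemma betti_shrink:
  assumes iso: "isolates_critical_value l M V k a b" and k: "k \<in> {1..l}"
    and "a \<le> \<alpha>" "\<alpha> < c k" "c k < \<beta>" "\<beta> \<le> b"
  shows "coeff.betti (qchains b :: nat \<Rightarrow> ('a set, 'g::ab_group_add) coeff_chain set) (qchains a) q =
    coeff.betti (qchains \<beta> :: nat \<Rightarrow> ('a set, 'g) coeff_chain set) (qchains \<alpha>) q"
proof -
  have only: "c j = c k" if "j \<in> {1..l}" "c j \<in> {a..b}" for j
    using iso that unfolding isolates_critical_value_def by blast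
  have "c j \<notin> {\<beta>..b}" "c j \<notin> {a..\<alpha>}" if "j \<in> {1..l}" for j
    using only[OF that] assms(3-6) by auto
  then have "coeff.betti (qchains b :: nat \<Rightarrow> ('a set, 'g) coeff_chain set) (qchains \<beta>) p = 0"
    "coeff.betti (qchains \<alpha> :: nat \<Rightarrow> ('a set, 'g) coeff_chain set) (qchains a) p = 0" for p
    using betti_regular[of \<beta> b p, where 'g = 'g] betti_regular[of a \<alpha> p, where 'g = 'g] assms(3-6) by auto
  then show ?thesis
    using coeff.betti_cancel_upper[of "qchains b :: nat \<Rightarrow> ('a set, 'g) coeff_chain set" "qchains \<beta>" "qchains a" q]
      coeff.betti_cancel_lower[of "qchains \<beta> :: nat \<Rightarrow> ('a set, 'g) coeff_chain set" "qchains \<alpha>" "qchains a" q]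
      qchains_mono[of \<beta> b, where 'g = 'g] qchains_mono[of a \<beta>, where 'g = 'g]
      qchains_mono[of \<alpha> \<beta>, where 'g = 'g] qchains_mono[of a \<alpha>, where 'g = 'g] assms(3-6)
    by (simp add: subcomplex_qchains)
qed

text \<open>Both intervals shrink to their intersection, which still has the critical value in its
  interior.\<close>

lemma betti_isolating:
  assumes "isolates_critical_value l M V k a b" "isolates_critical_value l M V k a' b'" "k \<in> {1..l}"
  shows "coeff.betti (qchains b :: nat \<Rightarrow> ('a set, 'g::ab_group_add) coeff_chain set) (qchains a) q =
    coeff.betti (qchains b' :: nat \<Rightarrow> ('a set, 'g) coeff_chain set) (qchains a') q"
  using betti_shrink[OF assms(1,3), of "max a a'" "min b b'" q, where 'g = 'g]
    betti_shrink[OF assms(2,3), of "max a a'" "min b b'" q, where 'g = 'g] assms(1,2)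
  by (simp add: isolates_critical_value_def)

theorem morse_equations:
  assumes levels: "\<And>k. k \<in> {1..l} \<Longrightarrow> isolates_critical_value l M V k (a' k) (b' k)"
    and b: "c l < b"
    and fin: "\<And>q k. k \<in> {1..l} \<Longrightarrow> group_rank (quotient_critical_group \<Omega> l M V q (a' k) (b' k)
      :: ('a set, 'g::ab_group_add) coeff_chain set monoid) < \<infinity>"
  shows "\<exists>\<beta> D. \<forall>q. group_rank (sublevel_homology \<Omega> l M V q b
      :: ('a set, 'g) coeff_chain set monoid) = enat (\<beta> q) \<and>
    (\<Sum>k=1..l. the_enat (group_rank (quotient_critical_group \<Omega> l M V q (a' k) (b' k)
      :: ('a set, 'g) coeff_chain set monoid))) = \<beta> q + D q + (if q = 0 then 0 else D (q - 1))"
proof -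
  let ?B = "\<lambda>a b q. coeff.betti (qchains b :: nat \<Rightarrow> ('a set, 'g) coeff_chain set) (qchains a) q"
  have l: "1 \<le> l" using decomposition by (simp add: morse_decomposition_def)
  have c_less: "c j < c k" if "1 \<le> j" "j < k" "k \<le> l" for j k
    using lyapunov that by (auto simp: strict_morse_lyapunov_def monotone_on_def)
  \<comment> \<open>The intermediate levels: 1 is an arbitrary drop below the lowest critical value,
    midpoints separate consecutive ones, and the last level is \<open>b\<close> itself, so that the
    final stage is V_b.\<close>
  define e where "e k = (if k = 0 then c 1 - 1 else if k < l then (c k + c (Suc k)) / 2 else b)" for k
  have e_upper: "c k < e k" if "k \<in> {1..l}" for k
    using that c_less[of k "Suc k"] b by (cases "k = l") (auto simp: e_def)
  have e_lower: "e k < c (Suc k)" if "k < l" for k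
    using that c_less[of k "Suc k"] by (auto simp: e_def)
  have e_iso: "isolates_critical_value l M V (Suc k) (e k) (e (Suc k))" if "k < l" for k
  proof -
    have "c j \<notin> {e k..e (Suc k)}" if j: "j \<in> {1..l}" "j \<noteq> Suc k" for j
    proof (cases "j \<le> k")
      case True
      then have "c j \<le> c k" using c_less[of j k] j \<open>k < l\<close> by (cases "j = k") auto
      then show ?thesis using e_upper[of k] True j \<open>k < l\<close> by auto
    next
      case False
      then have "Suc k < l" "c (Suc (Suc k)) \<le> c j"
        using j c_less[of "Suc (Suc k)" j] by (cases "j = Suc (Suc k)"; auto)+
      then show ?thesis using e_lower[of "Suc k"] by auto
    qed
    then show ?thesis
      using e_upper[of "Suc k"] e_lower[of k] \<open>k < l\<close>
      unfolding isolates_critical_value_def by fastforce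
  qed
  have e_mono: "e 0 \<le> e k" if "k \<le> l" for k
    using that
  proof (induction k)
    case (Suc k)
    then show ?case using e_lower[of k] e_upper[of "Suc k"] by auto
  qed simp
  have e_step: "e k \<le> e (Suc k)" if "k < l" for k
    using e_lower[OF that] e_upper[of "Suc k"] that by auto
  have rank_C: "group_rank (quotient_critical_group \<Omega> l M V q (a' k) (b' k)
      :: ('a set, 'g) coeff_chain set monoid) = ?B (a' k) (b' k) q" if "k \<in> {1..l}" for q k
    unfolding quotient_critical_group_def
    by (rule group_rank_qsub) (use levels[OF that] in \<open>simp add: isolates_critical_value_def\<close>)
  define m where "m k q = the_enat (?B (a' k) (b' k) q)" for k q
  have m: "?B (e k) (e (Suc k)) q = enat (m (Suc k) q)" if "k < l" for k q
  proof -
    have k: "Suc k \<in> {1..l}" using that by simp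
    have "?B (e k) (e (Suc k)) q = ?B (a' (Suc k)) (b' (Suc k)) q"
      by (rule betti_isolating[OF e_iso[OF that] levels[OF k] k])
    moreover have "?B (a' (Suc k)) (b' (Suc k)) q \<noteq> \<infinity>" using fin[OF k, of q] by (simp add: rank_C[OF k])
    ultimately show ?thesis by (auto simp: m_def)
  qed
  \<comment> \<open>All stages are measured relative to the level \<open>e 0\<close>; the triple
    consists of the levels \<open>e (Suc k)\<close>, \<open>e k\<close> and
    \<open>e 0\<close>.\<close>
  have step: "\<exists>r. \<forall>q. r q \<le> ?B (e 0) (e k) q \<and>
      ?B (e 0) (e k) q + enat (m (Suc k) q) = ?B (e 0) (e (Suc k)) q + r q + (if q = 0 then 0 else r (q - 1))"
    if k: "k < l" for k
  proof -
    have "\<exists>r. (\<forall>q. ?B (e 0) (e k) q + ?B (e k) (e (Suc k)) q =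
        ?B (e 0) (e (Suc k)) q + r q + (if q = 0 then 0 else r (q - 1))) \<and> (\<forall>q. r q \<le> ?B (e 0) (e k) q)"
      by (rule coeff.betti_triple[OF subcomplex_qchains subcomplex_qchains subcomplex_qchains
            qchains_mono[OF e_step[OF k]] qchains_mono[OF e_mono]])
         (use k in \<open>simp, blast\<close>)
    then show ?thesis unfolding m[OF k] by blast
  qed
  have B_0: "?B (e 0) (e 0) q = 0" for q
  proof (rule betti_regular)
    fix k assume "k \<in> {1..l}"
    then have "e 0 < c k" using c_less[of 1 k] by (cases "k = 1") (auto simp: e_def)
    then show "c k \<notin> {e 0..e 0}" by auto
  qed simp
  \<comment> \<open>Homology relative to the lowest level is therefore absolute homology, as in
    \<open>sublevel_homology\<close>.\<close>
  have "qsub (e 0) = {}"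
  proof (rule qsub_empty)
    fix k assume "k \<in> {1..l}"
    then show "e 0 < c k" using c_less[of 1 k] by (cases "k = 1") (auto simp: e_def)
  qed
  moreover have "e l = b" using l by (simp add: e_def)
  ultimately have rank_H: "group_rank (sublevel_homology \<Omega> l M V q b
      :: ('a set, 'g) coeff_chain set monoid) = ?B (e 0) (e l) q" for q
    unfolding sublevel_homology_def using group_rank_qsub[OF e_mono[of l], of q, where 'g = 'g] by simp
  have "\<exists>\<beta> D. \<forall>q. ?B (e 0) (e l) q = enat (\<beta> q) \<and>
      (\<Sum>k=1..l. m k q) = \<beta> q + D q + (if q = 0 then 0 else D (q - 1))"
    by (rule filtration_betti_numbers[where h = "\<lambda>k q. ?B (e 0) (e k) q", OF B_0 step])
  moreover have "(\<Sum>k=1..l. the_enat (group_rank (quotient_critical_group \<Omega> l M V q (a' k) (b' k)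
      :: ('a set, 'g) coeff_chain set monoid))) = (\<Sum>k=1..l. m k q)" for q
    by (rule sum.cong) (simp_all add: rank_C m_def)
  ultimately show ?thesis unfolding rank_H by simp
qed

end

theorem theorem6p11:
  fixes S :: "real \<Rightarrow> 'a::complete_space \<Rightarrow> 'a"
    and \<A> \<Omega> :: "'a set"
    and l :: nat
    and M :: "nat \<Rightarrow> 'a set"
    and V :: "'a \<Rightarrow> real"
    and c a' b' :: "nat \<Rightarrow> real"
    and b :: real
    and C :: "nat \<Rightarrow> nat \<Rightarrow> ('a set, 'g::ab_group_add) coeff_chain set monoid"
    and H :: "nat \<Rightarrow> ('a set, 'g) coeff_chain set monoid"
    and m \<beta> :: "nat \<Rightarrow> nat"
  assumes "semiflow S"
    and "asymptotically_compact S"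
    and "attractor S \<A>"
    and \<Omega>_def: "\<Omega> = attraction_basin S \<A>"
    and "morse_decomposition S \<A> l M"
    and "strict_morse_lyapunov S \<Omega> l M V"
    and c_def: "\<And>k. c k = critical_value V (M k)"
    and levels: "\<And>k. k \<in> {1..l} \<Longrightarrow> isolates_critical_value l M V k (a' k) (b' k)"
    and C_def: "\<And>q k. C q k = quotient_critical_group \<Omega> l M V q (a' k) (b' k)"
    and "c l < b"
    and H_def: "\<And>q. H q = sublevel_homology \<Omega> l M V q b"
    and m_def: "\<And>q. m q = (\<Sum>k=1..l. the_enat (group_rank (C q k)))"
    and \<beta>_def: "\<And>q. \<beta> q = the_enat (group_rank (H q))"
    and finite_rank: "\<And>q k. k \<in> {1..l} \<Longrightarrow> group_rank (C q k) < \<infinity>"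
  shows "(\<forall>q. group_rank (H q) < \<infinity>) \<and>
         (\<forall>q. (\<Sum>i\<le>q. (-1) ^ (q - i) * int (m i)) \<ge> (\<Sum>i\<le>q. (-1) ^ (q - i) * int (\<beta> i))) \<and>
         (summable (\<lambda>q. (-1) ^ q * real (m q)) \<longrightarrow>
           summable (\<lambda>q. (-1) ^ q * real (\<beta> q)) \<and>
           suminf (\<lambda>q. (-1) ^ q * real (m q)) = suminf (\<lambda>q. (-1) ^ q * real (\<beta> q)))"
proof -
  interpret flow: morse_flow S \<A> \<Omega> l M V
    by unfold_locales (use assms in auto)
  have "\<exists>\<beta>' D. \<forall>q. group_rank (H q) = enat (\<beta>' q) \<and>
      m q = \<beta>' q + D q + (if q = 0 then 0 else D (q - 1))"
    unfolding m_def H_def C_def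
    by (rule flow.morse_equations[OF levels])
       (use \<open>c l < b\<close> finite_rank in \<open>simp_all add: c_def C_def\<close>)
  then obtain \<beta>' D where rank: "\<And>q. group_rank (H q) = enat (\<beta>' q)"
    and eq: "\<And>q. m q = \<beta>' q + D q + (if q = 0 then 0 else D (q - 1))"
    by blast
  \<comment> \<open>\<open>the_enat\<close> returns the true rank only for finite ranks; that
    finiteness is part of \<open>rank\<close>.\<close>
  have "\<beta>' = \<beta>" by (simp add: fun_eq_iff \<beta>_def rank)
  then show ?thesis
    using rank alternating_sum_eq[of m \<beta> D] alternating_series_eq[of m \<beta> D] eq by simp
qed

end
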